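(* Let $d\ge1$ be an integer, and for $k=1,\ldots,d$ let $\beta_k\in(0,\frac\pi2)$ and $\alpha_k\in(0,\beta_k)$. There exist sequences $(\Psi_{k,i})_{i\ge1}$ and $(\tilde\Psi_{k,i})_{i\ge1}$ in $H^\infty_0(B_{\alpha_k})$, $k=1,\ldots,d$, such that: (1) for every real $p>0$ and every $k$, $\sup_{\zeta\in B_{\alpha_k}}\sum_{i\ge1}|\Psi_{k,i}(\zeta)|^p<\infty$ and $\sup_{\zeta\in B_{\alpha_k}}\sum_{i\ge1}|\tilde\Psi_{k,i}(\zeta)|^p<\infty$; (2) there is a constant $C>0$ such that for every bounded holomorphic $h$ on $B_{\beta_1}\times\cdots\times B_{\beta_d}$ there is a family $(a_{i_1,\ldots,i_d})_{i_1,\ldots,i_d\ge1}$ of complex numbers with $|a_{i_1,\ldots,i_d}|\le C\sup_{B_{\beta_1}\times\cdots\times B_{\beta_d}}|h|$ for all indices, and for every $(\zeta_1,\ldots,\zeta_d)\in B_{\alpha_1}\times\cdots\times B_{\alpha_d}$, $h(\zeta_1,\ldots,\zeta_d)=\sum_{i_1,\ldots,i_d\ge1}a_{i_1,\ldots,i_d}\Psi_{1,i_1}(\zeta_1)\tilde\Psi_{1,i_1}(\zeta_1)\cdots\Psi_{d,i_d}(\zeta_d)\tilde\Psi_{d,i_d}(\zeta_d)$.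
   Context: For $\gamma\in(0,\frac\pi2)$, the Stolz domain $B_\gamma$ is the interior of the convex hull of the point $1$ and the disc $D(0,\sin\gamma)$. $H^\infty_0(B_\gamma)$ is the set of bounded holomorphic functions $f$ on $B_\gamma$ such that $|f(\zeta)|\le c|1-\zeta|^s$ on $B_\gamma$ for some constants $c,s>0$. *)

theory Defs
  imports "HOL-Analysis.Analysis"
begin

definition stolz :: "real \<Rightarrow> complex set" where
  "stolz \<gamma> = interior (convex hull (insert 1 (ball 0 (sin \<gamma>))))"

definition Hinf0 :: "complex set \<Rightarrow> (complex \<Rightarrow> complex) set" where
  "Hinf0 B = {f. f holomorphic_on B \<and> bounded (f ` B) \<and>
      (\<exists>c s. c > 0 \<and> s > 0 \<and> (\<forall>z\<in>B. norm (f z) \<le> c * norm (1 - z) powr s))}"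

text \<open>Holomorphy of a function of several complex variables on a set of C^n:
  complex (Frechet) differentiability, i.e. real differentiable with complex-linear derivative.\<close>
definition holo_several :: "((complex, 'n::finite) vec \<Rightarrow> complex) \<Rightarrow> (complex, 'n) vec set \<Rightarrow> bool" where
  "holo_several h S \<longleftrightarrow> (\<forall>z\<in>S. \<exists>L. (h has_derivative L) (at z) \<and>
      (\<forall>(c::complex) v. L (\<chi> j. c * v $ j) = c * L v))"

end

theory Submission
  imports Defs "HOL-Complex_Analysis.Cauchy_Integral_Formula" "HOL-Real_Asymp.Real_Asymp"
begin

text \<open>For \<open>\<alpha> < \<gamma> < \<beta>\<close>, a point \<open>z\<close> outside \<open>stolz \<gamma>\<close> has distance at least a multiple of
  \<open>norm (1 - \<zeta>) + norm (1 - z)\<close> from every \<open>\<zeta>\<close> in \<open>stolz \<alpha>\<close>. The boundary of \<open>stolz \<gamma>\<close> is cut into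
  pieces that shrink geometrically towards the vertex \<open>1\<close>; on the piece at scale \<open>q ^ n\<close> the Cauchy kernel is
  expanded in a geometric series around a node of that piece. The additional factor
  \<open>csqrt (1 - \<zeta>) / csqrt (1 - z)\<close> makes the resulting functions of \<open>\<zeta>\<close> decay both when
  \<open>norm (1 - \<zeta>)\<close> is much smaller and when it is much larger than \<open>q ^ n\<close>, so that all their
  \<open>p\<close>-th power sums are bounded. They have no zeros, and both factors \<open>\<Psi>\<close>, \<open>\<Psi>t\<close> are taken to be
  a holomorphic square root. In several variables the one-variable integral representations are
  multiplied and the coefficients are integrals of \<open>h\<close> against a product measure.\<close>

subsection \<open>Stolz domains\<close>

text \<open>A bounded holomorphic \<open>h\<close> of several variables is not a sum of products, so
  a one-variable decomposition carries over only if its coefficients are given by integrals against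
  fixed densities: these can be multiplied and treated by Fubini. For this purpose the index sum and
  the integral over the arc parameter form one integral over \<open>index_measure\<close>, the same
  space for every variable and every pair of angles. Two sizes have to balance. At scale
  \<open>q ^ n\<close> the density is at most of order \<open>1 / q ^ n\<close> on an interval of
  length comparable to \<open>q ^ n\<close>, so its L1 norm is bounded in \<open>n\<close>. What
  remains for \<zeta> is the profile \<open>sqrt u / (1 + u)\<close> with
  \<open>u = q ^ n / norm (1 - \<zeta>)\<close>. Without the additional factor it would be
  \<open>u / (1 + u)\<close>, which stays near 1 for all scales above
  \<open>norm (1 - \<zeta>)\<close>; their number grows like
  \<open>ln (1 / norm (1 - \<zeta>))\<close>, and no uniform bound would hold. The price of the
  factor is a singularity of order \<open>t powr (- 1 / 2)\<close> at the vertex, which is still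
  integrable.\<close>

lemma convex_hull_stolz:
  assumes "0 < s"
  shows "convex hull (insert (1::complex) (ball 0 s)) = insert 1 {z. \<exists>l. 0 < l \<and> l \<le> 1 \<and> norm (1 - z - of_real l) < l * s}"
proof -
  have eq: "convex hull (insert (1::complex) (ball 0 s)) = {(1 - u) *\<^sub>R 1 + u *\<^sub>R x |x u. 0 \<le> u \<and> u \<le> 1 \<and> x \<in> ball 0 s}"
    using assms by (simp add: convex_hull_insert_alt hull_same)
  show ?thesis
    unfolding eq
  proof (intro equalityI subsetI)
    fix z :: complex assume "z \<in> {(1 - u) *\<^sub>R 1 + u *\<^sub>R x |x u. 0 \<le> u \<and> u \<le> 1 \<and> x \<in> ball 0 s}"
    then obtain x u where z: "z = (1 - u) *\<^sub>R 1 + u *\<^sub>R x" "0 \<le> u" "u \<le> 1" "norm x < s" by auto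
    have "norm (1 - z - of_real u) = u * norm x"
      using z by (simp add: scaleR_conv_of_real algebra_simps norm_mult)
    with z show "z \<in> insert 1 {z. \<exists>l. 0 < l \<and> l \<le> 1 \<and> norm (1 - z - of_real l) < l * s}"
      by (cases "u = 0") (auto intro!: exI[of _ u])
  next
    fix z :: complex assume "z \<in> insert 1 {z. \<exists>l. 0 < l \<and> l \<le> 1 \<and> norm (1 - z - of_real l) < l * s}"
    then consider "z = 1" | l where "0 < l" "l \<le> 1" "norm (1 - z - of_real l) < l * s" by auto
    then show "z \<in> {(1 - u) *\<^sub>R 1 + u *\<^sub>R x |x u. 0 \<le> u \<and> u \<le> 1 \<and> x \<in> ball 0 s}"
    proof cases
      case 1
      then show ?thesis using assms by (auto intro!: exI[of _ 0] exI[of _ "0::real"])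
    next
      case 2
      have "z = (1 - l) *\<^sub>R 1 + l *\<^sub>R (1 - (1 - z) / l)"
        using 2 by (simp add: scaleR_conv_of_real field_simps)
      moreover have "norm (1 - (1 - z) / l) < s"
      proof -
        have "1 - (1 - z) / l = - ((1 - z - of_real l) / of_real l)" using 2 by (simp add: field_simps)
        then have "norm (1 - (1 - z) / l) = norm (1 - z - of_real l) / l"
          using 2 by (simp add: norm_divide norm_minus_commute)
        moreover have "norm (1 - z - of_real l) / l < s" using 2 by (simp add: divide_simps mult.commute)
        ultimately show ?thesis by simp
      qed
      ultimately show ?thesis using 2 by (auto intro!: exI[of _ l])
    qed
  qed
qed

lemma sin_pos_less_one:
  assumes "0 < a" "a < pi / 2"
  shows "0 < sin a" "sin a < 1"
  using assms sin_gt_zero[of a] sin_monotone_2pi[of a "pi/2"] by auto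

text \<open>Here \<open>l\<close> is the weight of the disc in a convex combination with the vertex
  1, so \<open>z\<close> lies in the disc with centre \<open>1 - l\<close> and radius
  \<open>l * sin \<gamma>\<close>. Taking the interior removes exactly the vertex: these discs are
  open and lie in \<open>Re z < 1\<close>, while every neighbourhood of 1 has points of larger real
  part.\<close>

lemma mem_stolz_iff:
  assumes "0 < \<gamma>" "\<gamma> < pi / 2"
  shows "z \<in> stolz \<gamma> \<longleftrightarrow> (\<exists>l. 0 < l \<and> l \<le> 1 \<and> norm (1 - z - of_real l) < l * sin \<gamma>)"
proof -
  define s where "s = sin \<gamma>"
  have s: "0 < s" "s < 1" using sin_pos_less_one[OF assms] by (auto simp: s_def)
  define S where "S = {z::complex. \<exists>l. 0 < l \<and> l \<le> 1 \<and> norm (1 - z - of_real l) < l * s}"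
  have hull: "convex hull (insert (1::complex) (ball 0 s)) = insert 1 S"
    unfolding S_def by (rule convex_hull_stolz) fact
  have "S = (\<Union>l\<in>{0<..1}. ball (1 - of_real l) (l * s))"
    by (auto simp: S_def dist_norm norm_minus_commute algebra_simps)
  then have "open S" by auto
  have Re_less: "Re z < 1" if "z \<in> S" for z
  proof -
    from that obtain l where l: "0 < l" "l \<le> 1" "norm (1 - z - of_real l) < l * s"
      by (auto simp: S_def)
    have "\<bar>Re (1 - z - of_real l)\<bar> < l * s" using l(3) abs_Re_le_cmod order_le_less_trans by blast
    moreover have "l * s \<le> l" using l s by simp
    ultimately show ?thesis by auto
  qed
  have "interior (insert 1 S) = S"
  proof
    show "S \<subseteq> interior (insert 1 S)" using \<open>open S\<close> by (simp add: interior_maximal subset_insertI)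
    have "1 \<notin> interior (insert 1 S)"
    proof
      assume "1 \<in> interior (insert 1 S)"
      then obtain e where e: "e > 0" "ball 1 e \<subseteq> insert 1 S" by (auto simp: mem_interior)
      have "1 + of_real (e/2) \<in> ball (1::complex) e" using e by (simp add: dist_norm)
      then have "1 + of_real (e/2) \<in> S" using e by auto
      from Re_less[OF this] show False using e by simp
    qed
    then show "interior (insert 1 S) \<subseteq> S" using interior_subset[of "insert 1 S"] by blast
  qed
  then show ?thesis unfolding stolz_def hull[unfolded s_def] by (auto simp: S_def s_def)
qed

lemma open_stolz: "open (stolz \<gamma>)" and convex_stolz: "convex (stolz \<gamma>)"
  by (simp_all add: stolz_def convex_interior)

lemma stolz_bounds:
  assumes "0 < \<gamma>" "\<gamma> < pi / 2" "z \<in> stolz \<gamma>"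
  shows "Re z < 1" "norm (1 - z) \<le> 2" "norm z < 1"
proof -
  obtain l where l: "0 < l" "l \<le> 1" "norm (1 - z - of_real l) < l * sin \<gamma>"
    using assms mem_stolz_iff by blast
  have s: "0 < sin \<gamma>" "sin \<gamma> < 1" using sin_pos_less_one assms by auto
  have lt: "norm (1 - z - of_real l) < l"
  proof -
    have "l * sin \<gamma> \<le> l * 1" using l(1) s(2) by (intro mult_left_mono) auto
    with l(3) show ?thesis by simp
  qed
  have "norm z = norm (of_real (1 - l) - (1 - z - of_real l))" by simp
  also have "\<dots> \<le> (1 - l) + norm (1 - z - of_real l)"
    using norm_triangle_ineq4[of "of_real (1 - l)" "1 - z - of_real l"] l
    by (simp only: norm_of_real)
  finally show z: "norm z < 1" using lt by simp
  then show "Re z < 1" using complex_Re_le_cmod[of z] by simp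
  show "norm (1 - z) \<le> 2" using norm_triangle_ineq4[of 1 z] z by simp
qed

lemma zero_in_stolz:
  assumes "0 < \<gamma>" "\<gamma> < pi / 2" shows "0 \<in> stolz \<gamma>"
  using assms sin_pos_less_one[OF assms] by (auto simp: mem_stolz_iff intro!: exI[of _ 1])

lemma stolz_mono:
  assumes "0 < \<alpha>" "\<alpha> \<le> \<gamma>" "\<gamma> < pi / 2" shows "stolz \<alpha> \<subseteq> stolz \<gamma>"
proof
  fix z assume "z \<in> stolz \<alpha>"
  then obtain l where l: "0 < l" "l \<le> 1" "norm (1 - z - of_real l) < l * sin \<alpha>"
    using assms mem_stolz_iff[of \<alpha>] by auto
  have "sin \<alpha> \<le> sin \<gamma>" using assms sin_monotone_2pi_le[of \<alpha> \<gamma>] by auto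
  with l have "l * sin \<alpha> \<le> l * sin \<gamma>" by simp
  with l have "norm (1 - z - of_real l) < l * sin \<gamma>" by linarith
  with l show "z \<in> stolz \<gamma>" using assms by (subst mem_stolz_iff) (auto intro!: exI[of _ l])
qed

text \<open>At the weight \<open>l\<close> of \<zeta> the discs for \<alpha> and \<gamma> are
  concentric, with radii differing by \<open>l * (sin \<gamma> - sin \<alpha>)\<close>, and
  \<open>norm (1 - \<zeta>) \<le> 2 * l\<close>. So leaving \<open>stolz \<gamma>\<close> from
  \<zeta> costs a multiple of \<open>norm (1 - \<zeta>)\<close>; the triangle inequality then brings
  in \<open>norm (1 - z)\<close>.\<close>

lemma stolz_separation:
  assumes "0 < \<alpha>" "\<alpha> < \<gamma>" "\<gamma> < pi / 2"
  obtains \<kappa> where "0 < \<kappa>"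
    "\<And>z \<zeta>. \<zeta> \<in> stolz \<alpha> \<Longrightarrow> z \<notin> stolz \<gamma> \<Longrightarrow> \<kappa> * (norm (1 - \<zeta>) + norm (1 - z)) \<le> norm (z - \<zeta>)"
proof -
  define e where "e = (sin \<gamma> - sin \<alpha>) / 2"
  have "sin \<alpha> < sin \<gamma>" using assms sin_monotone_2pi[of \<alpha> \<gamma>] by auto
  then have e: "e > 0" by (simp add: e_def)
  have s: "0 < sin \<alpha>" "sin \<alpha> < 1" using sin_pos_less_one[of \<alpha>] assms by auto
  \<comment> \<open>The terms \<open>e * norm (1 - \<zeta>)\<close> and
    \<open>e * norm (1 - z)\<close> are at most 1 and \<open>1 + e\<close> times
    \<open>norm (z - \<zeta>)\<close>, which adds up to \<open>2 + e\<close>.\<close>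
  define k where "k = e / (2 + e)"
  have k: "k > 0" using e by (simp add: k_def)
  show ?thesis
  proof (rule that[OF k])
    fix z \<zeta> assume \<zeta>: "\<zeta> \<in> stolz \<alpha>" and z: "z \<notin> stolz \<gamma>"
    obtain l where l: "0 < l" "l \<le> 1" "norm (1 - \<zeta> - of_real l) < l * sin \<alpha>"
      using assms mem_stolz_iff[of \<alpha>] \<zeta> by auto
    have le2: "norm (1 - \<zeta>) \<le> 2 * l"
    proof -
      have "norm (1 - \<zeta>) \<le> norm (1 - \<zeta> - of_real l) + norm (of_real l :: complex)"
        using norm_triangle_ineq[of "1 - \<zeta> - of_real l" "of_real l"] by simp
      also have "\<dots> \<le> l * sin \<alpha> + l" using l by simp
      also have "\<dots> \<le> 2 * l" using l s by simp
      finally show ?thesis .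
    qed
    have 1: "e * norm (1 - \<zeta>) \<le> norm (z - \<zeta>)"
    proof (rule ccontr)
      assume "\<not> e * norm (1 - \<zeta>) \<le> norm (z - \<zeta>)"
      then have "norm (z - \<zeta>) < e * norm (1 - \<zeta>)" by simp
      also have "\<dots> \<le> e * (2 * l)" using le2 e by (intro mult_left_mono) auto
      finally have "norm (z - \<zeta>) < l * (sin \<gamma> - sin \<alpha>)" by (simp add: e_def mult.commute)
      moreover have "norm (1 - z - of_real l) \<le> norm (1 - \<zeta> - of_real l) + norm (z - \<zeta>)"
        using norm_triangle_ineq4[of "1 - \<zeta> - of_real l" "z - \<zeta>"] by (simp add: algebra_simps)
      ultimately have "norm (1 - z - of_real l) < l * sin \<gamma>" using l by (simp add: algebra_simps)
      then have "z \<in> stolz \<gamma>" using l assms by (subst mem_stolz_iff) auto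
      with z show False ..
    qed
    have "norm (1 - z) \<le> norm (1 - \<zeta>) + norm (z - \<zeta>)"
      using norm_triangle_ineq4[of "1 - \<zeta>" "z - \<zeta>"] by simp
    then have "e * norm (1 - z) \<le> e * norm (1 - \<zeta>) + e * norm (z - \<zeta>)"
      using e by (simp flip: distrib_left)
    then have "e * (norm (1 - \<zeta>) + norm (1 - z)) \<le> (2 + e) * norm (z - \<zeta>)"
      using 1 by (simp add: distrib_left distrib_right)
    then show "k * (norm (1 - \<zeta>) + norm (1 - z)) \<le> norm (z - \<zeta>)"
      using e by (simp add: k_def field_simps)
  qed
qed

text \<open>Contraction towards 0 changes the weight \<open>l\<close> into
  \<open>l' = 1 - r + r * l\<close>, because \<open>1 - r * z - l' = r * (1 - z - l)\<close>. The
  new weight is positive even for \<open>l = 0\<close>, so the vertex itself moves into the open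
  domain.\<close>

lemma stolz_scaled:
  assumes "0 < \<beta>" "\<beta> < pi / 2" "0 < s" "s < sin \<beta>" "0 \<le> l" "l \<le> 1" "norm (1 - z - of_real l) \<le> l * s"
    and "0 < r" "r < 1"
  shows "of_real r * z \<in> stolz \<beta>"
proof -
  define l' where "l' = 1 - r + r * l"
  have l': "0 < l'" using assms by (simp add: l'_def add_pos_nonneg)
  have "r * l \<le> r * 1" using assms by (intro mult_left_mono) auto
  then have "l' \<le> 1" by (simp add: l'_def)
  have "norm (1 - of_real r * z - of_real l') = norm (of_real r * (1 - z - of_real l))"
    by (simp add: l'_def algebra_simps)
  also have "\<dots> = r * norm (1 - z - of_real l)" using assms by (simp add: norm_mult)
  also have "\<dots> \<le> r * (l * s)" using assms by simp
  also have "\<dots> \<le> l' * s" using assms by (simp add: l'_def algebra_simps)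
  also have "\<dots> < l' * sin \<beta>" using assms l' by simp
  finally show ?thesis using l' \<open>l' \<le> 1\<close> assms by (subst mem_stolz_iff) auto
qed

lemma stolz_closed_hull:
  assumes "0 < \<beta>" "\<beta> < pi / 2" "0 < s" "s < sin \<beta>" "0 \<le> l" "l \<le> 1" "norm (1 - z - of_real l) \<le> l * s"
    and "z \<noteq> 1"
  shows "z \<in> stolz \<beta>"
proof -
  have "l > 0" using assms(5,7,8) by (cases "l = 0") auto
  then have "l * s < l * sin \<beta>" using assms by simp
  with assms(7) have "norm (1 - z - of_real l) < l * sin \<beta>" by linarith
  then show ?thesis using assms \<open>l > 0\<close> by (subst mem_stolz_iff) auto
qed

subsection \<open>Cauchy formula by dilation\<close>

lemma csqrt_one_minus_holomorphic:
  assumes "\<And>z. z \<in> S \<Longrightarrow> Re z < 1" shows "(\<lambda>z. csqrt (1 - z)) holomorphic_on S"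
proof (intro holomorphic_intros)
  fix z assume "z \<in> S"
  from assms[OF this] show "1 - z \<notin> \<real>\<^sub>\<le>\<^sub>0" by (auto simp: complex_nonpos_Reals_iff)
qed

text \<open>The dominating function for the dilation limit: on an arc the factor
  \<open>1 / csqrt (1 - z)\<close> is of order \<open>t powr (- 1 / 2)\<close>.\<close>

lemma integrable_powr_minus_half:
  "integrable lborel (\<lambda>t. indicator {0<..1} t * (K * t powr (- 1 / 2)) :: real)"
proof -
  have "(\<lambda>t. t powr (- 1 / 2)) absolutely_integrable_on {0<..1::real}"
    by (intro nonnegative_absolutely_integrable_1 integrable_on_powr_from_0') auto
  then have "integrable lebesgue (\<lambda>t. indicator {0<..1} t *\<^sub>R t powr (- 1 / 2) :: real)"
    by (simp add: set_integrable_def)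
  then have "integrable lborel (\<lambda>t. indicator {0<..1} t *\<^sub>R t powr (- 1 / 2) :: real)"
    by (subst (asm) integrable_completion) auto
  then have "integrable lborel (\<lambda>t. K * (indicator {0<..1} t *\<^sub>R t powr (- 1 / 2)) :: real)"
    by (rule integrable_mult_right)
  then show ?thesis by (simp add: mult_ac)
qed

text \<open>Dilation may halve the distance to the vertex but not more, uniformly in
  \<open>r\<close>: both \<open>norm (1 - r * z)\<close> itself and the displacement
  \<open>(1 - r) * norm z\<close> are controlled by
  \<open>norm (1 - r * z) \<ge> 1 - r\<close>.\<close>

lemma norm_one_minus_dilate:
  fixes z :: complex
  assumes "norm z \<le> 1" "0 < r" "r < 1"
  shows "norm (1 - z) \<le> 2 * norm (1 - of_real r * z)"
proof -
  have "1 - r \<le> norm (1 - of_real r * z)"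
  proof -
    have "norm (of_real r * z) \<le> r * 1"
      unfolding norm_mult norm_of_real using assms by (intro mult_mono) auto
    then show ?thesis using norm_triangle_ineq2[of 1 "of_real r * z"] by simp
  qed
  moreover have "norm (1 - z) \<le> norm (1 - of_real r * z) + (1 - r)"
  proof -
    have "1 - z = (1 - of_real r * z) - of_real (1 - r) * z" by (simp add: algebra_simps)
    then have "norm (1 - z) \<le> norm (1 - of_real r * z) + norm (of_real (1 - r) * z)"
      by (metis norm_triangle_ineq4)
    moreover have "norm (of_real (1 - r) * z) \<le> (1 - r) * 1"
      unfolding norm_mult norm_of_real using assms by (intro mult_mono) auto
    ultimately show ?thesis by simp
  qed
  ultimately show ?thesis by simp
qed

text \<open>The arcs meet at \<open>1\<close>, where \<open>g\<close> need not extend, so the Cauchy formula is applied to the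
  dilates \<open>z \<mapsto> \<Phi> (r * z)\<close>, \<open>\<Phi> z = g z / csqrt (1 - z)\<close>, and \<open>r\<close> tends to \<open>1\<close>.\<close>

lemma cauchy_formula_limit:
  fixes z dz :: "'c::finite \<Rightarrow> real \<Rightarrow> complex"
  assumes \<beta>: "0 < \<beta>" "\<beta> < pi / 2" and pos: "0 < \<kappa>" "0 < c" "0 < L"
    and \<zeta>: "\<zeta> \<in> stolz \<beta>"
    and sep: "\<And>s t. 0 < t \<Longrightarrow> t \<le> 1 \<Longrightarrow> \<kappa> \<le> norm (z s t - \<zeta>)"
    and z_lower: "\<And>s t. 0 < t \<Longrightarrow> t \<le> 1 \<Longrightarrow> c * t \<le> norm (1 - z s t)"
    and z_in: "\<And>s t. 0 < t \<Longrightarrow> t \<le> 1 \<Longrightarrow> z s t \<in> stolz \<beta>"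
    and z_cont: "\<And>s. continuous_on {0<..1} (z s)" and dz_cont: "\<And>s. continuous_on {0<..1} (dz s)"
    and dz_bound: "\<And>s t. 0 < t \<Longrightarrow> t \<le> 1 \<Longrightarrow> norm (dz s t) \<le> L"
    and dilate: "\<And>r u. 0 < r \<Longrightarrow> r < 1 \<Longrightarrow> u \<in> stolz \<beta> \<Longrightarrow> of_real r * u \<in> stolz \<beta>"
    and formula: "\<And>r \<Phi>. 0 < r \<Longrightarrow> r < 1 \<Longrightarrow> \<Phi> holomorphic_on stolz \<beta> \<Longrightarrow>
      ((\<lambda>t. \<Sum>s\<in>UNIV. \<Phi> (of_real r * z s t) * dz s t / (z s t - \<zeta>)) has_integral \<Phi> (of_real r * \<zeta>)) {0..1}"
    and g: "g holomorphic_on stolz \<beta>" "bounded (g ` stolz \<beta>)"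
  shows "(\<integral>t. indicator {0<..1} t *\<^sub>R
        (\<Sum>s\<in>UNIV. g (z s t) * (csqrt (1 - \<zeta>) / csqrt (1 - z s t)) * dz s t / (z s t - \<zeta>)) \<partial>lborel) = g \<zeta>"
proof -
  obtain G where G: "\<And>u. u \<in> stolz \<beta> \<Longrightarrow> norm (g u) \<le> G" using g(2) by (auto simp: bounded_iff)
  have G0: "0 \<le> G" using G[OF \<zeta>] norm_ge_zero order_trans by blast
  have nz: "1 - u \<noteq> 0" if "u \<in> stolz \<beta>" for u using stolz_bounds(1)[OF \<beta> that] by auto
  define \<Phi> where "\<Phi> u = g u / csqrt (1 - u)" for u
  have \<Phi>: "\<Phi> holomorphic_on stolz \<beta>"
    unfolding \<Phi>_def using csqrt_one_minus_holomorphic[of "stolz \<beta>"] stolz_bounds(1)[OF \<beta>] g(1) nz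
    by (intro holomorphic_on_divide) auto
  then have \<Phi>cont: "continuous_on (stolz \<beta>) \<Phi>" by (rule holomorphic_on_imp_continuous_on)
  define A where "A r t = (\<Sum>s\<in>UNIV. \<Phi> (of_real r * z s t) * dz s t / (z s t - \<zeta>))" for r t
  have inr: "of_real r * z s t \<in> stolz \<beta>" if "0 < t" "t \<le> 1" "0 < r" "r \<le> 1" for r s t
    using that dilate z_in by (cases "r = 1") auto
  have z_ne: "z s t - \<zeta> \<noteq> 0" if "0 < t" "t \<le> 1" for s t using sep[OF that, of s] pos by auto
  have meas: "(\<lambda>t. indicator {0<..1} t *\<^sub>R A r t) \<in> borel_measurable borel" if r: "0 < r" "r \<le> 1" for r
    unfolding A_def
  proof (intro borel_measurable_continuous_on_indicator continuous_on_sum continuous_intros z_cont dz_cont)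
    fix s show "continuous_on {0<..1} (\<lambda>t. \<Phi> (of_real r * z s t))"
      using inr r by (intro continuous_on_compose2[OF \<Phi>cont] continuous_intros z_cont) auto
  qed (use z_ne in auto)
  \<comment> \<open>One summand per arc: \<open>G\<close> bounds \<open>g\<close>,
    \<open>c * t / 2\<close> is below the distance of the dilated point to 1, \<open>L\<close>
    bounds the derivative, and \<kappa> is below the denominator. Nothing depends on
    \<open>r\<close>.\<close>
  define K where "K = of_nat CARD('c) * (G * sqrt 2 / sqrt c * L / \<kappa>)"
  have bound: "norm (indicator {0<..1} t *\<^sub>R A r t) \<le> indicator {0<..1} t * (K * t powr (- 1 / 2))"
    if r: "0 < r" "r < 1" for r t
  proof (cases "t \<in> {0<..1}")
    case True
    have "norm (\<Phi> (of_real r * z s t) * dz s t / (z s t - \<zeta>)) \<le> G * sqrt 2 / sqrt c * L / \<kappa> * t powr (- 1 / 2)" for s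
    proof -
      have "norm (z s t) \<le> 1" using True stolz_bounds(3)[OF \<beta> z_in, of t s] by auto
      then have "norm (1 - z s t) \<le> 2 * norm (1 - of_real r * z s t)" using r by (intro norm_one_minus_dilate)
      then have "c * t / 2 \<le> norm (1 - of_real r * z s t)" using True z_lower[of t s] by auto
      then have "sqrt (c * t / 2) \<le> sqrt (norm (1 - of_real r * z s t))" by simp
      then have "norm (\<Phi> (of_real r * z s t)) \<le> G / sqrt (c * t / 2)"
        unfolding \<Phi>_def norm_divide norm_csqrt using G[OF inr, of t r s] G0 True r pos by (intro frac_le) auto
      then have "norm (\<Phi> (of_real r * z s t) * dz s t / (z s t - \<zeta>)) \<le> G / sqrt (c * t / 2) * L / \<kappa>"
        unfolding norm_mult norm_divide using dz_bound[of t s] sep[of t s] True pos G0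
        by (intro frac_le mult_mono) auto
      also have "\<dots> = G * sqrt 2 / sqrt c * L / \<kappa> * t powr (- 1 / 2)"
        using True pos by (simp add: powr_minus powr_half_sqrt real_sqrt_mult real_sqrt_divide field_simps)
      finally show ?thesis .
    qed
    then have "norm (A r t) \<le> (\<Sum>s\<in>(UNIV :: 'c set). G * sqrt 2 / sqrt c * L / \<kappa> * t powr (- 1 / 2))"
      unfolding A_def by (intro norm_sum[THEN order_trans] sum_mono)
    then show ?thesis using True by (simp add: K_def mult_ac)
  qed simp
  note int_bound = integrable_powr_minus_half[of K]
  have eq: "(\<integral>t. indicator {0<..1} t *\<^sub>R A r t \<partial>lborel) = \<Phi> (of_real r * \<zeta>)" if r: "0 < r" "r < 1" for r
  proof -
    have "set_integrable lborel {0<..1} (A r)"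
      unfolding set_integrable_def
    proof (rule Bochner_Integration.integrable_bound[OF int_bound])
      show "AE t in lborel. norm (indicator {0<..1} t *\<^sub>R A r t) \<le> norm (indicator {0<..1} t * (K * t powr (- 1 / 2)))"
        using bound[OF r] by (intro always_eventually allI) (metis abs_ge_self order_trans real_norm_def)
    qed (use meas r in auto)
    then have "(\<integral>t. indicator {0<..1} t *\<^sub>R A r t \<partial>lborel) = integral {0<..1} (A r)"
      using set_borel_integral_eq_integral(2)[of "{0<..1}" "A r"] by (simp add: set_lebesgue_integral_def)
    \<comment> \<open>The omitted point 0 is the parameter of the vertex, a null set; this links the
      Lebesgue integral with the gauge integral in \<open>formula\<close>.\<close>
    also have "\<dots> = integral {0..1} (A r)"
      by (intro integral_spike_set[OF negligible_subset[of "{0}"] negligible_subset[of "{0}"]]) auto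
    also have "\<dots> = \<Phi> (of_real r * \<zeta>)"
      unfolding A_def[abs_def] using formula[OF r \<Phi>] by (rule integral_unique)
    finally show ?thesis .
  qed
  define \<rho> where "\<rho> j = 1 - 1 / (real j + 2)" for j :: nat
  have \<rho>: "0 < \<rho> j" "\<rho> j < 1" for j by (auto simp: \<rho>_def field_simps)
  have \<rho>lim: "\<rho> \<longlonglongrightarrow> 1" unfolding \<rho>_def by real_asymp
  have \<Phi>lim: "(\<lambda>j. \<Phi> (of_real (\<rho> j) * u)) \<longlonglongrightarrow> \<Phi> u" if u: "u \<in> stolz \<beta>" for u
  proof (rule isCont_tendsto_compose[of u \<Phi>])
    show "isCont \<Phi> u" using \<Phi>cont u open_stolz continuous_on_eq_continuous_at by blast
    have "(\<lambda>j. of_real (\<rho> j) * u) \<longlonglongrightarrow> of_real 1 * u" by (intro tendsto_intros \<rho>lim)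
    then show "(\<lambda>j. of_real (\<rho> j) * u) \<longlonglongrightarrow> u" by simp
  qed
  have "(\<lambda>j. \<integral>t. indicator {0<..1} t *\<^sub>R A (\<rho> j) t \<partial>lborel) \<longlonglongrightarrow> (\<integral>t. indicator {0<..1} t *\<^sub>R A 1 t \<partial>lborel)"
  proof (rule integral_dominated_convergence[OF _ _ int_bound])
    show "AE t in lborel. (\<lambda>j. indicator {0<..1} t *\<^sub>R A (\<rho> j) t) \<longlonglongrightarrow> indicator {0<..1} t *\<^sub>R A 1 t"
    proof (intro always_eventually allI)
      fix t :: real
      show "(\<lambda>j. indicator {0<..1} t *\<^sub>R A (\<rho> j) t) \<longlonglongrightarrow> indicator {0<..1} t *\<^sub>R A 1 t"
      proof (cases "t \<in> {0<..1}")
        case True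
        then have "(\<lambda>j. A (\<rho> j) t) \<longlonglongrightarrow> A 1 t"
          unfolding A_def using z_ne z_in \<Phi>lim by (intro tendsto_intros) auto
        then show ?thesis using True by simp
      qed simp
    qed
    show "AE t in lborel. norm (indicator {0<..1} t *\<^sub>R A (\<rho> j) t) \<le> indicator {0<..1} t * (K * t powr (- 1 / 2))" for j
      using bound[OF \<rho>] by (intro always_eventually) auto
    show "(\<lambda>t. indicator {0<..1} t *\<^sub>R A (\<rho> j) t) \<in> borel_measurable lborel" for j
      using meas[of "\<rho> j"] \<rho>[of j] by simp
    show "(\<lambda>t. indicator {0<..1} t *\<^sub>R A 1 t) \<in> borel_measurable lborel"
      using meas[of 1] by simp
  qed
  then have "(\<lambda>j. \<Phi> (of_real (\<rho> j) * \<zeta>)) \<longlonglongrightarrow> (\<integral>t. indicator {0<..1} t *\<^sub>R A 1 t \<partial>lborel)"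
    using eq \<rho> by simp
  then have lim: "(\<integral>t. indicator {0<..1} t *\<^sub>R A 1 t \<partial>lborel) = \<Phi> \<zeta>"
    using \<Phi>lim[OF \<zeta>] LIMSEQ_unique by blast
  have "(\<Sum>s\<in>UNIV. g (z s t) * (csqrt (1 - \<zeta>) / csqrt (1 - z s t)) * dz s t / (z s t - \<zeta>)) = csqrt (1 - \<zeta>) * A 1 t" for t
    by (simp add: A_def \<Phi>_def sum_distrib_left mult_ac)
  then have "(\<integral>t. indicator {0<..1} t *\<^sub>R
        (\<Sum>s\<in>UNIV. g (z s t) * (csqrt (1 - \<zeta>) / csqrt (1 - z s t)) * dz s t / (z s t - \<zeta>)) \<partial>lborel)
    = csqrt (1 - \<zeta>) * (\<integral>t. indicator {0<..1} t *\<^sub>R A 1 t \<partial>lborel)"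
    by (simp only: mult_scaleR_right[symmetric] integral_mult_right_zero)
  also have "\<dots> = g \<zeta>" using lim nz[OF \<zeta>] by (simp add: \<Phi>_def)
  finally show ?thesis .
qed

subsection \<open>Expansion of the Cauchy kernel\<close>

text \<open>With \<open>v n = (q ^ n / r) powr (p / 2)\<close>, the \<open>n\<close>-th term is dominated by a multiple of
  \<open>F n - F (Suc n)\<close> for \<open>F n = v n / (1 + v n)\<close>, so the sum telescopes.\<close>

lemma scale_sum_bound:
  fixes q p :: real
  assumes q: "0 < q" "q < 1" and p: "p > 0"
  obtains M where "M \<ge> 0" "\<And>r N. r > 0 \<Longrightarrow> (\<Sum>n<N. (sqrt (q ^ n / r) / (1 + q ^ n / r)) powr p) \<le> M"
proof -
  define b where "b = q powr (p / 2)"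
  have b: "0 < b" "b < 1" using q p powr_less_mono2[of "p/2" q 1] by (auto simp: b_def)
  have "(\<Sum>n<N. (sqrt (q ^ n / r) / (1 + q ^ n / r)) powr p) \<le> 4 / (1 - b)" if r: "r > 0" for r N
  proof -
    define v where "v n = (q ^ n / r) powr (p / 2)" for n
    define F where "F n = v n / (1 + v n)" for n
    have v: "v n > 0" for n using q r by (simp add: v_def)
    have vSuc: "v (Suc n) = b * v n" for n
      using q r by (simp add: v_def b_def powr_mult[symmetric] mult.assoc)
    have summand: "(sqrt (q ^ n / r) / (1 + q ^ n / r)) powr p \<le> 4 / (1 - b) * (F n - F (Suc n))" for n
    proof -
      define u where "u = q ^ n / r"
      have u: "u > 0" using q r by (simp add: u_def)
      \<comment> \<open>Since \<open>y\<close> dominates both 1 and \<open>v n\<close>, it dominates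
        their mean, whatever \<open>p > 0\<close> is. Squaring the mean produces the constant
        4.\<close>
      define y where "y = (1 + u) powr (p / 2)"
      have vu: "v n = u powr (p/2)" by (simp add: v_def u_def)
      have "1 \<le> y" using u p by (simp add: y_def ge_one_powr_ge_zero)
      moreover have "v n \<le> y" unfolding vu y_def using u p by (intro powr_mono2) auto
      ultimately have y: "(1 + v n) / 2 \<le> y" by simp
      have sq: "sqrt u powr p = v n" using u by (simp add: vu powr_half_sqrt[symmetric] powr_powr)
      have "(sqrt u / (1 + u)) powr p = v n / (1 + u) powr p"
        using u by (simp add: powr_divide sq)
      also have "(1 + u) powr p = y ^ 2"
        using u by (simp add: y_def power2_eq_square powr_add[symmetric])
      also have "v n / y ^ 2 \<le> v n / ((1 + v n) / 2) ^ 2"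
        using v[of n] y by (intro divide_left_mono power_mono mult_pos_pos zero_less_power) auto
      also have "\<dots> = 4 * (v n / ((1 + v n) * (1 + v n)))"
        by (simp add: power2_eq_square)
      \<comment> \<open>Lowering one factor to \<open>1 + b * v n\<close>, that is
        \<open>1 + v (Suc n)\<close>, makes the quotient equal to
        \<open>(F n - F (Suc n)) / (1 - b)\<close>.\<close>
      also have "\<dots> \<le> 4 * (v n / ((1 + v n) * (1 + b * v n)))"
        using v[of n] b by (intro mult_left_mono divide_left_mono mult_mono) (auto intro!: mult_pos_pos add_pos_pos)
      also have "\<dots> = 4 / (1 - b) * (F n - F (Suc n))"
      proof -
        have "1 + v n \<noteq> 0" "1 + b * v n \<noteq> 0" "1 - b \<noteq> 0"
          using v[of n] b by (auto simp: add_pos_pos less_imp_neq[symmetric])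
        then show ?thesis unfolding F_def vSuc by (simp add: divide_simps) (simp add: algebra_simps)
      qed
      finally show ?thesis by (simp add: u_def)
    qed
    have "(\<Sum>n<N. (sqrt (q ^ n / r) / (1 + q ^ n / r)) powr p) \<le> (\<Sum>n<N. 4 / (1 - b) * (F n - F (Suc n)))"
      by (intro sum_mono summand)
    also have "\<dots> = 4 / (1 - b) * (F 0 - F N)"
      by (simp only: sum_distrib_left[symmetric] sum_lessThan_telescope')
    also have "\<dots> \<le> 4 / (1 - b) * 1"
    proof (intro mult_left_mono)
      have "F 0 \<le> 1" "F N \<ge> 0" using v[of 0] v[of N] by (auto simp: F_def)
      then show "F 0 - F N \<le> 1" by simp
    qed (use b in auto)
    finally show ?thesis by simp
  qed
  then show ?thesis using b by (intro that[of "4 / (1 - b)"]) auto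
qed

text \<open>Arcs \<open>z s\<close> issuing from the vertex \<open>1\<close> that together carry a Cauchy formula; \<open>dz s\<close> is the
  derivative of the arc including orientation and the factor \<open>1 / (2 * pi * \<i>)\<close>.\<close>

locale cauchy_arcs =
  fixes \<alpha> \<beta> \<kappa> c L q :: real and z dz :: "'c::finite \<Rightarrow> real \<Rightarrow> complex"
  assumes \<alpha>: "0 < \<alpha>" "\<alpha> < pi / 2" and \<beta>: "0 < \<beta>" "\<beta> < pi / 2"
    and pos: "0 < \<kappa>" "0 < c" "c \<le> 1" "0 < L" and q: "0 < q" "q < 1" "L * (1 - q) \<le> \<kappa> * c / 2"
    and sep: "\<And>s t \<zeta>. 0 < t \<Longrightarrow> t \<le> 1 \<Longrightarrow> \<zeta> \<in> stolz \<alpha> \<Longrightarrow>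
      \<kappa> * (norm (1 - \<zeta>) + norm (1 - z s t)) \<le> norm (z s t - \<zeta>)"
    and z_lower: "\<And>s t. 0 < t \<Longrightarrow> t \<le> 1 \<Longrightarrow> c * t \<le> norm (1 - z s t)"
    and z_lip: "\<And>s t t'. 0 < t \<Longrightarrow> t \<le> t' \<Longrightarrow> t' \<le> 1 \<Longrightarrow> norm (z s t' - z s t) \<le> L * (t' - t)"
    and z_in: "\<And>s t. 0 < t \<Longrightarrow> t \<le> 1 \<Longrightarrow> z s t \<in> stolz \<beta>"
    and z_cont: "\<And>s. continuous_on {0<..1} (z s)" and dz_cont: "\<And>s. continuous_on {0<..1} (dz s)"
    and dz_bound: "\<And>s t. 0 < t \<Longrightarrow> t \<le> 1 \<Longrightarrow> norm (dz s t) \<le> L"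
    and cauchy: "\<And>g \<zeta>. g holomorphic_on stolz \<beta> \<Longrightarrow> bounded (g ` stolz \<beta>) \<Longrightarrow> \<zeta> \<in> stolz \<alpha> \<Longrightarrow>
      (\<integral>t. indicator {0<..1} t *\<^sub>R
        (\<Sum>s\<in>UNIV. g (z s t) * (csqrt (1 - \<zeta>) / csqrt (1 - z s t)) * dz s t / (z s t - \<zeta>)) \<partial>lborel) = g \<zeta>"
begin

section \<open>Nodes, pieces and the two factors of the expanded kernel\<close>

definition node :: "'c \<Rightarrow> nat \<Rightarrow> complex" where "node s n = z s (q ^ n)"

text \<open>This radius fits between two requirements: it is at most half the distance from the node
  to \<open>stolz \<alpha>\<close> (\<open>node_dist\<close>), and, by the choice
  \<open>L * (1 - q) \<le> \<kappa> * c / 2\<close>, it is at least the distance from the node to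
  any point of its piece of arc (\<open>node_piece\<close>). Hence the ratio 1/2 in the geometric
  series.\<close>

definition R :: "nat \<Rightarrow> real" where "R n = \<kappa> * c * q ^ n / 2"

text \<open>The half-open intervals partition \<open>{0<..1}\<close>, so exactly one scale is active
  at each parameter.\<close>

definition piece :: "nat \<Rightarrow> real set" where "piece n = {q ^ Suc n<..q ^ n}"

text \<open>From \<open>1 / (z - \<zeta>) = (\<Sum>m. (node - z) ^ m / (node - \<zeta>) ^ Suc
  m)\<close>: \<open>f\<close> collects what depends on \<zeta>, \<phi> what depends on
  \<open>t\<close>. The powers of \<open>R n\<close> and the factor \<open>sqrt (q ^ n)\<close>
  cancel in the product; they distribute the size so that \<open>f\<close> decays in
  \<open>m\<close> and the L1 norm of \<phi> is bounded.\<close>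

definition f :: "'c \<times> nat \<times> nat \<Rightarrow> complex \<Rightarrow> complex" where
  "f = (\<lambda>(s, n, m) \<zeta>. of_real (sqrt (q ^ n)) * csqrt (1 - \<zeta>) * of_real (R n) ^ m / (node s n - \<zeta>) ^ Suc m)"

definition \<phi> :: "'c \<times> nat \<times> nat \<Rightarrow> real \<Rightarrow> complex" where
  "\<phi> = (\<lambda>(s, n, m) t. indicator (piece n) t *\<^sub>R
     (dz s t / (of_real (sqrt (q ^ n)) * csqrt (1 - z s t)) * ((node s n - z s t) / of_real (R n)) ^ m))"

text \<open>Off \<open>{0<..1}\<close> the value is 0, a point of \<open>stolz \<beta>\<close>, so
  that \<open>g\<close> is evaluated inside its domain for every real \<open>t\<close>.\<close>

definition w :: "'c \<times> nat \<times> nat \<Rightarrow> real \<Rightarrow> complex" where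
  "w = (\<lambda>(s, n, m) t. indicator {0<..1} t *\<^sub>R z s t)"

lemma qn: "0 < q ^ n" "q ^ n \<le> 1" using q by (auto intro: power_le_one)

lemma R_pos: "0 < R n" using pos qn by (simp add: R_def)

lemma piece_subset: "t \<in> piece n \<Longrightarrow> 0 < t \<and> t \<le> 1"
  using qn[of n] qn[of "Suc n"] by (auto simp: piece_def)

lemma one_minus_pos: "\<zeta> \<in> stolz \<alpha> \<Longrightarrow> 0 < norm (1 - \<zeta>)"
  using stolz_bounds(1)[OF \<alpha>, of \<zeta>] by auto

lemma node_dist:
  assumes "\<zeta> \<in> stolz \<alpha>"
  shows "\<kappa> * c * (norm (1 - \<zeta>) + q ^ n) \<le> norm (node s n - \<zeta>)" "2 * R n \<le> norm (node s n - \<zeta>)"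
    "node s n \<noteq> \<zeta>"
proof -
  have "c * norm (1 - \<zeta>) + c * q ^ n \<le> norm (1 - \<zeta>) + norm (1 - node s n)"
    using z_lower[OF qn[of n], of s] pos mult_left_le_one_le[of "norm (1 - \<zeta>)" c]
    by (intro add_mono) (auto simp: node_def)
  then have "\<kappa> * (c * norm (1 - \<zeta>) + c * q ^ n) \<le> \<kappa> * (norm (1 - \<zeta>) + norm (1 - node s n))"
    using pos by (intro mult_left_mono) auto
  also have "\<dots> \<le> norm (node s n - \<zeta>)" unfolding node_def using sep qn assms by blast
  finally show *: "\<kappa> * c * (norm (1 - \<zeta>) + q ^ n) \<le> norm (node s n - \<zeta>)" by (simp add: algebra_simps)
  have "\<kappa> * c * q ^ n \<le> \<kappa> * c * (norm (1 - \<zeta>) + q ^ n)" using pos by (intro mult_left_mono) auto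
  with * show R: "2 * R n \<le> norm (node s n - \<zeta>)" by (simp add: R_def)
  then show "node s n \<noteq> \<zeta>" using R_pos[of n] by auto
qed

lemma norm_f:
  "norm (f (s, n, m) \<zeta>) = sqrt (q ^ n) * sqrt (norm (1 - \<zeta>)) / norm (node s n - \<zeta>) * (R n / norm (node s n - \<zeta>)) ^ m"
  using qn[of n] R_pos[of n] by (simp add: f_def norm_mult norm_divide norm_power power_divide)

lemma ratio_le:
  assumes "\<zeta> \<in> stolz \<alpha>" shows "0 \<le> R n / norm (node s n - \<zeta>)" "R n / norm (node s n - \<zeta>) \<le> 1 / 2"
proof -
  have "0 < norm (node s n - \<zeta>)" using node_dist(3)[OF assms] by simp
  then show "0 \<le> R n / norm (node s n - \<zeta>)" "R n / norm (node s n - \<zeta>) \<le> 1 / 2"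
    using node_dist(2)[OF assms, of n s] R_pos[of n] by (auto simp: field_simps)
qed

text \<open>With \<open>r = norm (1 - \<zeta>)\<close>, the quotient
  \<open>sqrt (q ^ n) * sqrt r / (r + q ^ n)\<close> depends only on \<open>q ^ n / r\<close>;
  dividing by \<open>r\<close> gives the summand of \<open>scale_sum_bound\<close>. The factor
  \<open>(1 / 2) ^ m\<close> comes from \<open>ratio_le\<close>.\<close>

lemma norm_f_le:
  assumes \<zeta>: "\<zeta> \<in> stolz \<alpha>"
  shows "norm (f (s, n, m) \<zeta>) \<le>
    1 / (\<kappa> * c) * (sqrt (q ^ n / norm (1 - \<zeta>)) / (1 + q ^ n / norm (1 - \<zeta>))) * (1 / 2) ^ m"
proof -
  define r where "r = norm (1 - \<zeta>)"
  have r: "r > 0" using one_minus_pos[OF \<zeta>] by (simp add: r_def)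
  have "sqrt (q ^ n) * sqrt r / norm (node s n - \<zeta>) \<le> sqrt (q ^ n) * sqrt r / (\<kappa> * c * (r + q ^ n))"
    using node_dist(1)[OF \<zeta>, of n s] node_dist(3)[OF \<zeta>, of s n] pos r qn[of n]
    by (intro divide_left_mono) (auto simp: r_def intro!: mult_pos_pos add_pos_pos)
  also have "\<dots> = 1 / (\<kappa> * c) * (sqrt (q ^ n / r) / (1 + q ^ n / r))"
  proof -
    have sum: "r + q ^ n = r * (1 + q ^ n / r)" using r by (simp add: field_simps)
    have root: "sqrt (q ^ n) * sqrt r / r = sqrt (q ^ n / r)"
      using r by (simp add: real_sqrt_divide field_simps)
    have "sqrt (q ^ n) * sqrt r / (\<kappa> * c * (r * (1 + q ^ n / r))) = 1 / (\<kappa> * c) * ((sqrt (q ^ n) * sqrt r / r) / (1 + q ^ n / r))"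
      by simp
    then show ?thesis unfolding sum root .
  qed
  finally have 1: "sqrt (q ^ n) * sqrt r / norm (node s n - \<zeta>) \<le> 1 / (\<kappa> * c) * (sqrt (q ^ n / r) / (1 + q ^ n / r))" .
  have "(R n / norm (node s n - \<zeta>)) ^ m \<le> (1 / 2) ^ m"
    using ratio_le[OF \<zeta>] by (intro power_mono) auto
  with 1 show ?thesis unfolding norm_f r_def[symmetric]
    using ratio_le(1)[OF \<zeta>] pos r qn[of n]
    by (intro mult_mono) (auto intro!: mult_nonneg_nonneg divide_nonneg_nonneg)
qed

text \<open>For a fixed index the decay at the vertex comes from the factor
  \<open>csqrt (1 - \<zeta>)\<close> alone; the constant may depend on \<open>n\<close>, as
  \<open>Hinf0\<close> is a condition on each function separately.\<close>

lemma norm_f_le_sqrt: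
  assumes \<zeta>: "\<zeta> \<in> stolz \<alpha>"
  shows "norm (f (s, n, m) \<zeta>) \<le> sqrt (q ^ n) / (2 * R n) * sqrt (norm (1 - \<zeta>))"
proof -
  have "R n / norm (node s n - \<zeta>) \<le> 1" using ratio_le[OF \<zeta>, of n s] by linarith
  then have "norm (f (s, n, m) \<zeta>) \<le> sqrt (q ^ n) * sqrt (norm (1 - \<zeta>)) / norm (node s n - \<zeta>) * 1"
    unfolding norm_f using ratio_le(1)[OF \<zeta>, of n s] qn[of n] q
    by (intro mult_left_mono power_le_one) auto
  also have "\<dots> \<le> sqrt (q ^ n) * sqrt (norm (1 - \<zeta>)) / (2 * R n) * 1"
    using node_dist(2)[OF \<zeta>, of n s] node_dist(3)[OF \<zeta>, of s n] R_pos[of n] qn[of n]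
    by (intro mult_right_mono divide_left_mono) auto
  finally show ?thesis by simp
qed

lemma f_sqrt:
  obtains g where "g holomorphic_on stolz \<alpha>" "\<And>\<zeta>. \<zeta> \<in> stolz \<alpha> \<Longrightarrow> f i \<zeta> = g \<zeta> ^ 2"
proof -
  obtain s n m where i: "i = (s, n, m)" by (cases i)
  have "(\<lambda>\<zeta>. csqrt (1 - \<zeta>)) holomorphic_on stolz \<alpha>"
    using stolz_bounds(1)[OF \<alpha>] by (rule csqrt_one_minus_holomorphic)
  then have "f i holomorphic_on stolz \<alpha>"
    unfolding f_def i prod.case using node_dist(3)
    by (intro holomorphic_on_mult holomorphic_on_divide holomorphic_on_power holomorphic_on_diff
        holomorphic_on_const holomorphic_on_ident) auto
  moreover have "contractible (stolz \<alpha>)" using convex_stolz by (rule convex_imp_contractible)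
  moreover have "f i \<zeta> \<noteq> 0" if "\<zeta> \<in> stolz \<alpha>" for \<zeta>
    using one_minus_pos[OF that] node_dist(3)[OF that, of s n] R_pos[of n] qn[of n] q by (simp add: f_def i)
  ultimately show ?thesis using that by (rule contractible_imp_holomorphic_sqrt)
qed

section \<open>The densities on the pieces\<close>

lemma node_piece:
  assumes "t \<in> piece n" shows "norm (node s n - z s t) \<le> R n"
proof -
  have "norm (node s n - z s t) \<le> L * (q ^ n - t)"
    unfolding node_def using assms piece_subset[OF assms] qn by (intro z_lip) (auto simp: piece_def)
  also have "\<dots> \<le> L * ((1 - q) * q ^ n)" using assms pos by (intro mult_left_mono) (auto simp: piece_def algebra_simps)
  also have "\<dots> = L * (1 - q) * q ^ n" by simp
  also have "\<dots> \<le> \<kappa> * c / 2 * q ^ n" using q qn[of n] by (intro mult_right_mono) auto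
  finally show ?thesis by (simp add: R_def)
qed

text \<open>On the piece \<open>t > q * q ^ n\<close>, so
  \<open>norm (1 - z s t) \<ge> c * q * q ^ n\<close>, and the two square roots in the denominator
  multiply to at least \<open>sqrt (c * q) * q ^ n\<close>. The node quotient is at most 1. Since
  the piece is no longer than \<open>q ^ n\<close>, the integral is bounded independently of all
  indices.\<close>

lemma norm_phi: "norm (\<phi> (s, n, m) t) \<le> L / sqrt (c * q) / q ^ n * indicator (piece n) t"
proof (cases "t \<in> piece n")
  case True
  note t = piece_subset[OF True]
  have "norm ((node s n - z s t) / of_real (R n)) ^ m \<le> 1"
    using node_piece[OF True, of s] R_pos[of n] by (intro power_le_one) (auto simp: norm_divide)
  moreover have "norm (dz s t / (of_real (sqrt (q ^ n)) * csqrt (1 - z s t))) \<le> L / sqrt (c * q) / q ^ n"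
  proof -
    have "c * q * q ^ n \<le> c * t" using True pos by (simp add: piece_def mult.assoc)
    also have "\<dots> \<le> norm (1 - z s t)" using t z_lower by blast
    finally have le: "c * q * q ^ n \<le> norm (1 - z s t)" .
    have "sqrt (c * q) * q ^ n = sqrt (q ^ n) * sqrt (c * q * q ^ n)"
      using qn[of n] by (simp add: real_sqrt_mult)
    also have "\<dots> \<le> sqrt (q ^ n) * sqrt (norm (1 - z s t))"
      using le qn[of n] q by (intro mult_left_mono real_sqrt_le_mono real_sqrt_ge_zero) auto
    finally have le: "sqrt (c * q) * q ^ n \<le> sqrt (q ^ n) * sqrt (norm (1 - z s t))" .
    have "norm (dz s t / (of_real (sqrt (q ^ n)) * csqrt (1 - z s t))) = norm (dz s t) / (sqrt (q ^ n) * sqrt (norm (1 - z s t)))"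
      using qn[of n] by (simp add: norm_divide norm_mult)
    also have "\<dots> \<le> L / (sqrt (c * q) * q ^ n)"
      using le dz_bound[of t s] t pos q qn[of n] by (intro frac_le) auto
    finally show ?thesis by simp
  qed
  ultimately have "norm (dz s t / (of_real (sqrt (q ^ n)) * csqrt (1 - z s t))) * norm ((node s n - z s t) / of_real (R n)) ^ m
      \<le> L / sqrt (c * q) / q ^ n * 1"
    using pos q qn[of n] by (intro mult_mono) auto
  then show ?thesis using True
    by (simp only: \<phi>_def prod.case norm_mult norm_power indicator_simps scaleR_one mult_1_right)
qed (simp add: \<phi>_def)

lemma phi_measurable [measurable]: "\<phi> i \<in> borel_measurable borel"
proof -
  obtain s n m where i: "i = (s, n, m)" by (cases i)
  have sub: "piece n \<subseteq> {0<..1}" using piece_subset by auto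
  have [continuous_intros]: "continuous_on (piece n) (z s)" "continuous_on (piece n) (dz s)"
    using z_cont dz_cont sub continuous_on_subset by blast+
  have nz: "Re (z s t) < 1" if "t \<in> piece n" for t
    using z_in piece_subset[OF that] stolz_bounds(1)[OF \<beta>] by blast
  have [continuous_intros]: "continuous_on (piece n) (\<lambda>t. csqrt (1 - z s t))"
  proof (rule continuous_on_compose2[OF continuous_on_csqrt])
    show "(\<lambda>t. 1 - z s t) ` piece n \<subseteq> - \<real>\<^sub>\<le>\<^sub>0" using nz by (force simp: complex_nonpos_Reals_iff)
  qed (intro continuous_intros)
  have "continuous_on (piece n) (\<lambda>t. dz s t / (of_real (sqrt (q ^ n)) * csqrt (1 - z s t)) * ((node s n - z s t) / of_real (R n)) ^ m)"
    using nz qn[of n] R_pos[of n] q by (intro continuous_intros) fastforce+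
  then show ?thesis
    unfolding \<phi>_def i prod.case by (intro borel_measurable_continuous_on_indicator) (auto simp: piece_def)
qed

lemma w_measurable [measurable]: "w i \<in> borel_measurable borel"
  unfolding w_def using z_cont
  by (cases i) (auto intro!: borel_measurable_continuous_on_indicator)

lemma w_in: "w i t \<in> stolz \<beta>"
  using z_in zero_in_stolz[OF \<beta>] by (cases i) (auto simp: w_def indicator_def)

lemma integrable_phi: "integrable lborel (\<phi> i)" "(\<integral>t. norm (\<phi> i t) \<partial>lborel) \<le> L / sqrt (c * q)"
proof -
  obtain s n m where i: "i = (s, n, m)" by (cases i)
  define K where "K = L / sqrt (c * q)"
  have K: "0 \<le> K" using pos q by (simp add: K_def)
  have le_qn: "q ^ Suc n \<le> q ^ n" using q by (simp add: mult_left_le_one_le)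
  then have fin: "emeasure lborel (piece n) < \<infinity>" unfolding piece_def by (subst emeasure_lborel_Ioc) auto
  have int: "integrable lborel (\<lambda>t. K / q ^ n * indicator (piece n) t :: real)"
    using fin by (intro integrable_mult_right integrable_real_indicator) (auto simp: piece_def)
  have le: "norm (\<phi> i t) \<le> K / q ^ n * indicator (piece n) t" for t
    using norm_phi unfolding i K_def .
  show int': "integrable lborel (\<phi> i)"
  proof (rule Bochner_Integration.integrable_bound[OF int])
    have "norm (\<phi> i t) \<le> norm (K / q ^ n * indicator (piece n) t)" for t
      using le[of t] by (metis abs_ge_self order_trans real_norm_def)
    then show "AE t in lborel. norm (\<phi> i t) \<le> norm (K / q ^ n * indicator (piece n) t)" by simp
  qed simp
  have "(\<integral>t. norm (\<phi> i t) \<partial>lborel) \<le> (\<integral>t. K / q ^ n * indicator (piece n) t \<partial>lborel)"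
    by (intro integral_mono int le integrable_norm int')
  also have "\<dots> = K / q ^ n * (q ^ n - q ^ Suc n)"
    using le_qn by (simp add: piece_def)
  also have "\<dots> \<le> K / q ^ n * q ^ n" using K qn[of n] qn[of "Suc n"] by (intro mult_left_mono) auto
  also have "\<dots> = K" using q by simp
  finally show "(\<integral>t. norm (\<phi> i t) \<partial>lborel) \<le> L / sqrt (c * q)" by (simp add: K_def)
qed

section \<open>Power sums and the one-variable representation\<close>

text \<open>The majorant in \<open>norm_f_le\<close> is a product, so its \<open>p\<close>-th power
  separates: finitely many arcs, the scales by \<open>scale_sum_bound\<close>, which is uniform in
  \<open>norm (1 - \<zeta>)\<close>, and a geometric series in \<open>m\<close>. Finite subsets keep
  the bound independent of any enumeration.\<close>

lemma sum_f_bound: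
  assumes p: "p > 0"
  obtains M where "\<And>\<zeta> S. \<zeta> \<in> stolz \<alpha> \<Longrightarrow> finite S \<Longrightarrow> (\<Sum>i\<in>S. norm (f i \<zeta>) powr p) \<le> M"
proof -
  obtain M0 where M0: "M0 \<ge> 0" "\<And>r N. r > 0 \<Longrightarrow> (\<Sum>n<N. (sqrt (q ^ n / r) / (1 + q ^ n / r)) powr p) \<le> M0"
    using scale_sum_bound[OF q(1,2) p] by blast
  define K where "K = (1 / (\<kappa> * c)) powr p"
  define b where "b = (1 / 2 :: real) powr p"
  have b: "0 < b" "b < 1" using p powr_less_mono2[of p "1/2" 1] by (auto simp: b_def)
  have "(\<Sum>i\<in>S. norm (f i \<zeta>) powr p) \<le> of_nat CARD('c) * (K * M0 * (1 / (1 - b)))"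
    if \<zeta>: "\<zeta> \<in> stolz \<alpha>" and S: "finite S" for \<zeta> S
  proof -
    define r where "r = norm (1 - \<zeta>)"
    have r: "r > 0" using one_minus_pos[OF \<zeta>] by (simp add: r_def)
    define A where "A n = (sqrt (q ^ n / r) / (1 + q ^ n / r)) powr p" for n
    have le: "norm (f (s, n, m) \<zeta>) powr p \<le> K * (A n * b ^ m)" for s n m
    proof -
      have "norm (f (s, n, m) \<zeta>) powr p \<le> (1 / (\<kappa> * c) * (sqrt (q ^ n / r) / (1 + q ^ n / r)) * (1 / 2) ^ m) powr p"
        using norm_f_le[OF \<zeta>] p by (intro powr_mono2) (auto simp: r_def)
      also have "\<dots> = K * (A n * b ^ m)"
      proof -
        have half: "((1 / 2 :: real) ^ m) powr p = b ^ m"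
          by (simp add: b_def powr_realpow[symmetric] powr_powr mult.commute)
        have "(x * y * v) powr p = x powr p * (y powr p * v powr p)"
          if "x \<ge> 0" "y \<ge> 0" "v \<ge> 0" for x y v :: real
          using that by (simp add: powr_mult mult.assoc)
        then show ?thesis unfolding K_def A_def half[symmetric] by this (use pos r qn[of n] q in auto)
      qed
      finally show ?thesis .
    qed
    obtain N where N: "fst ` snd ` S \<union> snd ` snd ` S \<subseteq> {..<N}"
      using S by (meson finite_imageI finite_UnI finite_nat_iff_bounded)
    have sub: "S \<subseteq> UNIV \<times> {..<N} \<times> {..<N}" using N by force
    have "(\<Sum>i\<in>S. norm (f i \<zeta>) powr p) \<le> (\<Sum>i\<in>UNIV \<times> {..<N} \<times> {..<N}. norm (f i \<zeta>) powr p)"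
      using sub by (intro sum_mono2) auto
    also have "\<dots> \<le> (\<Sum>(s, n, m)\<in>(UNIV :: 'c set) \<times> {..<N} \<times> {..<N}. K * (A n * b ^ m))"
      using le by (intro sum_mono) auto
    also have "\<dots> = (\<Sum>s\<in>(UNIV :: 'c set). \<Sum>n<N. \<Sum>m<N. K * (A n * b ^ m))"
      by (simp only: sum.cartesian_product)
    also have "\<dots> = of_nat CARD('c) * (K * (\<Sum>n<N. A n) * (\<Sum>m<N. b ^ m))"
    proof -
      have "(\<Sum>n<N. \<Sum>m<N. K * (A n * b ^ m)) = K * (\<Sum>n<N. A n) * (\<Sum>m<N. b ^ m)"
        unfolding mult.assoc sum_product by (simp only: sum_distrib_left)
      then show ?thesis by simp
    qed
    also have "\<dots> \<le> of_nat CARD('c) * (K * M0 * (1 / (1 - b)))"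
    proof (intro mult_left_mono mult_mono)
      show "(\<Sum>n<N. A n) \<le> M0" unfolding A_def using M0 r by blast
      have "(\<Sum>m<N. b ^ m) \<le> (\<Sum>m. b ^ m)" using b by (intro sum_le_suminf) (auto simp: summable_geometric)
      then show "(\<Sum>m<N. b ^ m) \<le> 1 / (1 - b)" using b by (simp add: suminf_geometric)
    qed (use M0 b in \<open>auto simp: K_def intro!: sum_nonneg\<close>)
    finally show ?thesis .
  qed
  then show ?thesis by (rule that)
qed

text \<open>For fixed \<open>t\<close> only the scale whose piece contains \<open>t\<close>
  contributes. There the sum over \<open>m\<close> is the geometric series of the Cauchy kernel
  around the node, with ratio at most 1/2 in norm, and the sum over the arcs is finite.\<close>

lemma expansion:
  assumes \<zeta>: "\<zeta> \<in> stolz \<alpha>"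
  shows "((\<lambda>i. f i \<zeta> * \<phi> i t * g (w i t)) has_sum (indicator {0<..1} t *\<^sub>R
    (\<Sum>s\<in>UNIV. g (z s t) * (csqrt (1 - \<zeta>) / csqrt (1 - z s t)) * dz s t / (z s t - \<zeta>)))) UNIV"
proof (cases "t \<in> {0<..1}")
  case False
  then have "\<phi> i t = 0" for i using piece_subset by (cases i) (auto simp: \<phi>_def indicator_def)
  then show ?thesis using False by simp
next
  case True
  \<comment> \<open>The upper bound \<open>t \<le> q ^ n\<close> follows from minimality, and from
    \<open>t \<le> 1\<close> when \<open>n = 0\<close>.\<close>
  define n where "n = (LEAST n. q ^ Suc n < t)"
  have "\<exists>n. q ^ n < t" using True q by (intro real_arch_pow_inv) auto
  then obtain n' where "q ^ n' < t" by blast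
  moreover have "n' \<noteq> 0" using calculation True by (cases n') auto
  ultimately have ex: "\<exists>n. q ^ Suc n < t" by (metis not0_implies_Suc)
  have n: "t \<in> piece n"
  proof -
    have "q ^ Suc n < t" unfolding n_def using ex by (rule LeastI_ex)
    moreover have "t \<le> q ^ n"
    proof (cases n)
      case (Suc k)
      then have "\<not> q ^ Suc k < t" unfolding n_def by (intro not_less_Least) simp
      then show ?thesis using Suc by simp
    qed (use True in auto)
    ultimately show ?thesis by (simp add: piece_def)
  qed
  have uniq: "t \<notin> piece n'" if "n' \<noteq> n" for n'
  proof
    assume "t \<in> piece n'"
    then have "q ^ Suc n' < t" "t \<le> q ^ n'" "q ^ Suc n < t" "t \<le> q ^ n" using n by (auto simp: piece_def)
    then have "q ^ Suc n' < q ^ n" "q ^ Suc n < q ^ n'" by linarith+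
    then have "n < Suc n'" "n' < Suc n" using q by (simp_all only: power_strict_decreasing_iff)
    then show False using that by simp
  qed
  define F where "F i = f i \<zeta> * \<phi> i t * g (w i t)" for i
  define \<rho> where "\<rho> s = (node s n - z s t) / (node s n - \<zeta>)" for s
  define Y where "Y s = g (z s t) * (csqrt (1 - \<zeta>) / csqrt (1 - z s t)) * dz s t / (node s n - \<zeta>)" for s
  have F: "F (s, n, m) = Y s * \<rho> s ^ m" for s m
  proof -
    have "complex_of_real (R n) \<noteq> 0" "complex_of_real (sqrt (q ^ n)) \<noteq> 0"
      using R_pos[of n] qn[of n] q by auto
    \<comment> \<open>The cancellation in free variables. As division by zero gives 0, both sides
      vanish when \<open>d = 0\<close> or \<open>B = 0\<close>.\<close>
    moreover have "a * A * r ^ m / d ^ Suc m * (D / (a * B) * (N / r) ^ m) * G = G * (A / B) * D / d * (N / d) ^ m"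
      if "r \<noteq> 0" "a \<noteq> 0" for a A r d D B N G :: complex
      using that by (cases "d = 0"; cases "B = 0") (simp_all add: power_divide field_simps)
    ultimately show ?thesis using n True
      unfolding F_def f_def \<phi>_def w_def Y_def \<rho>_def prod.case by (simp only: indicator_simps scaleR_one)
  qed
  have \<rho>: "norm (\<rho> s) \<le> 1 / 2" for s
  proof -
    have "norm (\<rho> s) \<le> R n / norm (node s n - \<zeta>)"
      unfolding \<rho>_def norm_divide using node_piece[OF n] by (intro divide_right_mono) auto
    then show ?thesis using ratio_le(2)[OF \<zeta>, of n s] by linarith
  qed
  have Y: "Y s / (1 - \<rho> s) = g (z s t) * (csqrt (1 - \<zeta>) / csqrt (1 - z s t)) * dz s t / (z s t - \<zeta>)" for s
  proof -
    have "(node s n - \<zeta>) * (1 - \<rho> s) = z s t - \<zeta>"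
      using node_dist(3)[OF \<zeta>, of s n] by (simp add: \<rho>_def field_simps)
    then show ?thesis by (simp add: Y_def)
  qed
  have geo: "((\<lambda>m. F (s, n, m)) has_sum Y s / (1 - \<rho> s)) UNIV" for s
  proof (rule norm_summable_imp_has_sum)
    show "summable (\<lambda>m. norm (F (s, n, m)))"
      unfolding F norm_mult norm_power using \<rho>[of s] by (intro summable_mult summable_geometric) simp
    show "(\<lambda>m. F (s, n, m)) sums (Y s / (1 - \<rho> s))"
      unfolding F using sums_mult[OF geometric_sums[of "\<rho> s"], of "Y s"] \<rho>[of s] by simp
  qed
  \<comment> \<open>The same series with norms: it supplies the absolute summability needed to sum
    over arcs and powers jointly.\<close>
  have geo': "((\<lambda>m. norm (F (s, n, m))) has_sum norm (Y s) / (1 - norm (\<rho> s))) UNIV" for s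
  proof (rule norm_summable_imp_has_sum)
    show "summable (\<lambda>m. norm (norm (F (s, n, m))))"
      unfolding F norm_mult norm_power using \<rho>[of s] by (intro summable_mult summable_geometric) simp
    show "(\<lambda>m. norm (F (s, n, m))) sums (norm (Y s) / (1 - norm (\<rho> s)))"
      unfolding F norm_mult norm_power using sums_mult[OF geometric_sums[of "norm (\<rho> s)"], of "norm (Y s)"] \<rho>[of s] by simp
  qed
  have "(\<lambda>(s, m). norm (F (s, n, m))) summable_on Sigma (UNIV :: 'c set) (\<lambda>_. UNIV)"
    by (rule summable_on_SigmaI[where g = "\<lambda>s. norm (Y s) / (1 - norm (\<rho> s))"]) (use geo' in auto)
  then have "(\<lambda>(s, m). F (s, n, m)) summable_on Sigma (UNIV :: 'c set) (\<lambda>_. UNIV)"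
    using abs_summable_summable[of "\<lambda>(s, m). F (s, n, m)" "Sigma UNIV (\<lambda>_. UNIV)"]
    by (simp add: case_prod_unfold)
  then have "((\<lambda>(s, m). F (s, n, m)) has_sum (\<Sum>s\<in>UNIV. Y s / (1 - \<rho> s))) (Sigma (UNIV :: 'c set) (\<lambda>_. UNIV))"
    by (intro has_sum_SigmaI[where g = "\<lambda>s. Y s / (1 - \<rho> s)"] has_sum_finite) (use geo in auto)
  also have "?this \<longleftrightarrow> ((F \<circ> (\<lambda>(s, m). (s, n, m))) has_sum (\<Sum>s\<in>UNIV. Y s / (1 - \<rho> s))) UNIV"
    by (simp add: o_def case_prod_unfold)
  also have "\<dots> \<longleftrightarrow> (F has_sum (\<Sum>s\<in>UNIV. Y s / (1 - \<rho> s))) (range (\<lambda>(s, m). (s, n, m)))"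
    by (intro has_sum_reindex[symmetric]) (auto simp: inj_on_def)
  \<comment> \<open>Indices of all other scales contribute 0, because \<open>t\<close> lies in no
    other piece.\<close>
  also have "\<dots> \<longleftrightarrow> (F has_sum (\<Sum>s\<in>UNIV. Y s / (1 - \<rho> s))) UNIV"
  proof (rule has_sum_cong_neutral)
    fix i :: "'c \<times> nat \<times> nat" assume i: "i \<in> UNIV - range (\<lambda>(s, m). (s, n, m))"
    obtain s n' m where i': "i = (s, n', m)" by (cases i)
    then have "n' \<noteq> n" using i by (auto simp: image_iff)
    then show "F i = 0" using uniq by (simp add: F_def i' \<phi>_def)
  qed auto
  finally show ?thesis using True by (simp add: F_def[abs_def] Y)
qed

text \<open>The index sum and the integral over \<open>t\<close> become one integral on a product
  space; the enumeration \<open>e\<close> replaces the triples by natural numbers, so that the space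
  no longer depends on the arcs. Each \<phi> has L1 norm at most \<open>L / sqrt (c * q)\<close>,
  hence absolute convergence reduces to that of the sum of
  \<open>norm (f i \<zeta>)\<close>.\<close>

lemma integral_representation:
  fixes e :: "nat \<Rightarrow> 'c \<times> nat \<times> nat"
  assumes e: "bij e" and \<zeta>: "\<zeta> \<in> stolz \<alpha>" and g: "g holomorphic_on stolz \<beta>" "bounded (g ` stolz \<beta>)"
  shows "integrable (count_space UNIV \<Otimes>\<^sub>M lborel) (\<lambda>x. f (e (fst x)) \<zeta> * \<phi> (e (fst x)) (snd x) * g (w (e (fst x)) (snd x)))"
    and "(\<integral>x. f (e (fst x)) \<zeta> * \<phi> (e (fst x)) (snd x) * g (w (e (fst x)) (snd x)) \<partial>(count_space UNIV \<Otimes>\<^sub>M lborel)) = g \<zeta>"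
proof -
  interpret pair_sigma_finite "count_space (UNIV :: nat set)" lborel
    by (intro pair_sigma_finite.intro sigma_finite_measure_count_space_countable sigma_finite_lborel) auto
  define F where "F j t = f (e j) \<zeta> * \<phi> (e j) t * g (w (e j) t)" for j t
  obtain G where G: "\<And>u. u \<in> stolz \<beta> \<Longrightarrow> norm (g u) \<le> G" using g(2) by (auto simp: bounded_iff)
  have G0: "0 \<le> G" using G[OF zero_in_stolz[OF \<beta>]] norm_ge_zero order_trans by blast
  have [measurable]: "(\<lambda>t. g (w i t)) \<in> borel_measurable borel" for i
  proof -
    have "(\<lambda>u. indicator (stolz \<beta>) u *\<^sub>R g u) \<in> borel_measurable borel"
      using g(1) open_stolz
      by (intro borel_measurable_continuous_on_indicator holomorphic_on_imp_continuous_on) auto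
    then have "(\<lambda>t. indicator (stolz \<beta>) (w i t) *\<^sub>R g (w i t)) \<in> borel_measurable borel"
      using measurable_compose[OF w_measurable] by blast
    then show ?thesis using w_in by simp
  qed
  have [measurable]: "F j \<in> borel_measurable lborel" for j unfolding F_def by measurable
  have Fle: "norm (F j t) \<le> norm (f (e j) \<zeta>) * G * norm (\<phi> (e j) t)" for j t
    using mult_left_mono[OF G[OF w_in, of "e j" t], of "norm (f (e j) \<zeta>) * norm (\<phi> (e j) t)"]
    by (simp add: F_def norm_mult mult_ac)
  have int: "integrable lborel (F j)" for j
    by (rule Bochner_Integration.integrable_bound[where f = "\<lambda>t. norm (f (e j) \<zeta>) * G * norm (\<phi> (e j) t)"])
       (use integrable_phi Fle G0 in \<open>auto intro!: integrable_mult_right integrable_norm\<close>)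
  define K where "K = L / sqrt (c * q)"
  have intF: "(\<integral>t. norm (F j t) \<partial>lborel) \<le> norm (f (e j) \<zeta>) * (G * K)" for j
  proof -
    have "(\<integral>t. norm (F j t) \<partial>lborel) \<le> (\<integral>t. norm (f (e j) \<zeta>) * G * norm (\<phi> (e j) t) \<partial>lborel)"
      using Fle integrable_phi int by (intro integral_mono integrable_mult_right integrable_norm)
    also have "\<dots> = norm (f (e j) \<zeta>) * G * (\<integral>t. norm (\<phi> (e j) t) \<partial>lborel)" by simp
    also have "\<dots> \<le> norm (f (e j) \<zeta>) * G * K"
      using integrable_phi(2)[of "e j"] G0 by (intro mult_left_mono) (auto simp: K_def)
    finally show ?thesis by (simp add: mult.assoc)
  qed
  \<comment> \<open>The case \<open>p = 1\<close> of the power sums, transported along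
    \<open>e\<close>.\<close>
  have sum: "summable (\<lambda>j. norm (f (e j) \<zeta>))"
  proof -
    obtain M where M: "\<And>\<zeta> S. \<zeta> \<in> stolz \<alpha> \<Longrightarrow> finite S \<Longrightarrow> (\<Sum>i\<in>S. norm (f i \<zeta>) powr 1) \<le> M"
      using sum_f_bound[of 1] by auto
    show ?thesis
    proof (rule summableI_nonneg_bounded)
      fix n
      have "(\<Sum>j<n. norm (f (e j) \<zeta>)) = (\<Sum>i\<in>e ` {..<n}. norm (f i \<zeta>))"
        using e by (subst sum.reindex) (auto simp: bij_def inj_on_def)
      then show "(\<Sum>j<n. norm (f (e j) \<zeta>)) \<le> M" using M[OF \<zeta>, of "e ` {..<n}"] by simp
    qed auto
  qed
  have sumF: "summable (\<lambda>j. \<integral>t. norm (F j t) \<partial>lborel)"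
    by (rule summable_comparison_test'[OF summable_mult2[OF sum, of "G * K"], of 0])
       (use intF in auto)
  have "integrable (count_space UNIV \<Otimes>\<^sub>M lborel) (\<lambda>x. F (fst x) (snd x))"
  proof (rule Fubini_integrable)
    show "(\<lambda>x. F (fst x) (snd x)) \<in> borel_measurable (count_space UNIV \<Otimes>\<^sub>M lborel)"
      by (rule measurable_pair_measure_countable1) auto
    show "integrable (count_space UNIV) (\<lambda>j. \<integral>t. norm (F (fst (j, t)) (snd (j, t))) \<partial>lborel)"
      using sumF by (simp add: integrable_count_space_nat_iff)
  qed (use int in auto)
  then show int2: "integrable (count_space UNIV \<Otimes>\<^sub>M lborel) (\<lambda>x. f (e (fst x)) \<zeta> * \<phi> (e (fst x)) (snd x) * g (w (e (fst x)) (snd x)))"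
    by (simp add: F_def)
  have "(\<integral>x. F (fst x) (snd x) \<partial>(count_space UNIV \<Otimes>\<^sub>M lborel)) = (\<integral>j. (\<integral>t. F j t \<partial>lborel) \<partial>count_space UNIV)"
    using integral_fst'[OF int2] by (simp add: F_def)
  also have "\<dots> = (\<Sum>j. \<integral>t. F j t \<partial>lborel)"
  proof (rule integral_count_space_nat)
    have "summable (\<lambda>j. norm (\<integral>t. F j t \<partial>lborel))"
      by (rule summable_comparison_test'[OF sumF, of 0]) (auto intro: integral_norm_bound)
    then show "integrable (count_space UNIV) (\<lambda>j. \<integral>t. F j t \<partial>lborel)" by (simp add: integrable_count_space_nat_iff)
  qed
  also have "\<dots> = (\<integral>t. (\<Sum>j. F j t) \<partial>lborel)"
  proof (rule integral_suminf[symmetric])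
    have "summable (\<lambda>j. norm (F j t))" for t
    proof -
      have "(\<lambda>i. f i \<zeta> * \<phi> i t * g (w i t)) summable_on UNIV" using expansion[OF \<zeta>] summable_on_def by blast
      then have "(\<lambda>i. norm (f i \<zeta> * \<phi> i t * g (w i t))) summable_on UNIV"
        by (simp only: summable_on_iff_abs_summable_on_complex)
      then have "(\<lambda>j. norm (F j t)) summable_on UNIV"
        unfolding F_def using summable_on_reindex_bij_betw[OF e, of "\<lambda>i. norm (f i \<zeta> * \<phi> i t * g (w i t))"] by simp
      then show ?thesis by (rule summable_on_imp_summable)
    qed
    then show "AE t in lborel. summable (\<lambda>j. norm (F j t))" by simp
  qed (use int sumF in auto)
  also have "\<dots> = g \<zeta>"
  proof -
    have "(\<Sum>j. F j t) = indicator {0<..1} t *\<^sub>R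
      (\<Sum>s\<in>UNIV. g (z s t) * (csqrt (1 - \<zeta>) / csqrt (1 - z s t)) * dz s t / (z s t - \<zeta>))" for t
    proof -
      have "((\<lambda>j. F j t) has_sum (indicator {0<..1} t *\<^sub>R
        (\<Sum>s\<in>UNIV. g (z s t) * (csqrt (1 - \<zeta>) / csqrt (1 - z s t)) * dz s t / (z s t - \<zeta>)))) UNIV"
        unfolding F_def using expansion[OF \<zeta>, of t g] has_sum_reindex_bij_betw[OF e, of "\<lambda>i. f i \<zeta> * \<phi> i t * g (w i t)"] by simp
      then show ?thesis by (rule has_sum_imp_sums[THEN sums_unique, symmetric])
    qed
    then show ?thesis using cauchy[OF g \<zeta>] by simp
  qed
  finally show "(\<integral>x. f (e (fst x)) \<zeta> * \<phi> (e (fst x)) (snd x) * g (w (e (fst x)) (snd x)) \<partial>(count_space UNIV \<Otimes>\<^sub>M lborel)) = g \<zeta>"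
    by (simp add: F_def)
qed

end

subsection \<open>The boundary of a Stolz domain\<close>

text \<open>The supporting line in direction \<theta>: on the disc at weight \<open>l\<close> the
  functional \<open>Re (z * cis (- \<theta>))\<close> stays below
  \<open>(1 - l) * cos \<theta> + l * sin \<gamma>\<close>, which is at most
  \<open>sin \<gamma>\<close>, its value at the given point.\<close>

lemma cis_notin_stolz:
  assumes \<gamma>: "0 < \<gamma>" "\<gamma> < pi / 2" and \<theta>: "cos \<theta> \<le> sin \<gamma>"
  shows "of_real (sin \<gamma>) * cis \<theta> \<notin> stolz \<gamma>"
proof
  assume "of_real (sin \<gamma>) * cis \<theta> \<in> stolz \<gamma>"
  then obtain l where l: "0 < l" "l \<le> 1" "norm (1 - of_real (sin \<gamma>) * cis \<theta> - of_real l) < l * sin \<gamma>"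
    using mem_stolz_iff[OF \<gamma>] by auto
  have "Re ((1 - of_real (sin \<gamma>) * cis \<theta> - of_real l) * cis (- \<theta>)) = (1 - l) * cos \<theta> - sin \<gamma>"
  proof -
    have "(1 - of_real (sin \<gamma>) * cis \<theta> - of_real l) * cis (- \<theta>) = of_real (1 - l) * cis (- \<theta>) - of_real (sin \<gamma>) * (cis \<theta> * cis (- \<theta>))"
      by (simp add: algebra_simps)
    then show ?thesis by (simp add: cis_mult)
  qed
  moreover have "\<bar>Re ((1 - of_real (sin \<gamma>) * cis \<theta> - of_real l) * cis (- \<theta>))\<bar> < l * sin \<gamma>"
    using l(3) abs_Re_le_cmod[of "(1 - of_real (sin \<gamma>) * cis \<theta> - of_real l) * cis (- \<theta>)"] by (simp add: norm_mult)
  moreover have "(1 - l) * cos \<theta> \<le> (1 - l) * sin \<gamma>" using l \<theta> by (intro mult_left_mono) auto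
  ultimately show False by (simp add: algebra_simps)
qed

text \<open>These points lie on a tangent through the vertex: the line has distance
  \<open>l * sin \<gamma>\<close> from the centre \<open>1 - l\<close> of the disc at weight
  \<open>l\<close>, by \<open>(x - l * cos \<gamma>)\<^sup>2 + (l * sin \<gamma>)\<^sup>2\<close>.
  The condition on \<open>cos \<delta>\<close> covers both signs of the angle.\<close>

lemma edge_notin_stolz:
  assumes \<gamma>: "0 < \<gamma>" "\<gamma> < pi / 2" and \<delta>: "cos \<delta> = cos \<gamma>" and x: "0 \<le> x"
  shows "1 - of_real x * cis \<delta> \<notin> stolz \<gamma>"
proof
  assume "1 - of_real x * cis \<delta> \<in> stolz \<gamma>"
  then obtain l where l: "0 < l" "l \<le> 1" "norm (of_real x * cis \<delta> - of_real l) < l * sin \<gamma>"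
    using mem_stolz_iff[OF \<gamma>] by auto
  have "(norm (of_real x * cis \<delta> - of_real l))\<^sup>2 = (x * cos \<delta> - l)\<^sup>2 + (x * sin \<delta>)\<^sup>2"
    by (simp add: cmod_power2)
  also have "\<dots> = (x - l * cos \<gamma>)\<^sup>2 + l\<^sup>2 * (1 - (cos \<gamma>)\<^sup>2)"
    unfolding \<delta>[symmetric] using sin_cos_squared_add[of \<delta>] by algebra
  also have "\<dots> \<ge> (l * sin \<gamma>)\<^sup>2" by (simp add: power_mult_distrib sin_squared_eq)
  finally have "l * sin \<gamma> \<le> norm (of_real x * cis \<delta> - of_real l)" by (rule power2_le_imp_le) simp
  with l show False by simp
qed

text \<open>The right triangle formed by 0, 1 and a point of tangency has hypotenuse 1 and legs
  \<open>sin \<gamma>\<close> and \<open>cos \<gamma>\<close>.\<close>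

lemma one_minus_tangent:
  "1 - of_real (sin \<gamma>) * cis (pi / 2 - \<gamma>) = of_real (cos \<gamma>) * cis (- \<gamma>)"
  "1 - of_real (sin \<gamma>) * cis (\<gamma> - pi / 2) = of_real (cos \<gamma>) * cis \<gamma>"
  using sin_cos_squared_add3[of \<gamma>] by (simp_all add: complex_eq_iff sin_diff cos_diff algebra_simps)

text \<open>On the two segments, which lie in the right half plane, \<open>Ln\<close> is a primitive
  of \<open>1 / w\<close>; the arc crosses the cut of \<open>Ln\<close> and is integrated directly.
  The logarithms of \<open>s\<close> cancel, and the angles \<theta>,
  \<open>2 * pi - 2 * \<theta>\<close> and \<theta> add up to a full turn.\<close>

lemma stolz_boundary_winding_number:
  fixes \<gamma> :: real
  defines "s \<equiv> sin \<gamma>" and "\<theta> \<equiv> pi / 2 - \<gamma>"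
  defines "\<Gamma> \<equiv> linepath 1 (of_real s * cis \<theta>) +++ part_circlepath 0 s \<theta> (2 * pi - \<theta>) +++ linepath (of_real s * cis (- \<theta>)) 1"
  assumes \<gamma>: "0 < \<gamma>" "\<gamma> < pi / 2"
  shows "winding_number \<Gamma> 0 = 1"
proof -
  have s: "0 < s" "s < 1" using sin_pos_less_one[OF \<gamma>] by (auto simp: s_def)
  have \<theta>: "0 < \<theta>" "\<theta> < pi / 2" using \<gamma> by (auto simp: \<theta>_def)
  have cos\<theta>: "cos \<theta> > 0" using \<theta> by (intro cos_gt_zero) auto
  have pos: "closed_segment 1 (of_real s * cis x) \<subseteq> {z. Re z > 0}" if "cos x > 0" for x
    using that s by (intro closed_segment_subset convex_halfspace_Re_gt) auto
  \<comment> \<open>The arc ends at the angle \<open>2 * pi - \<theta>\<close>, while the last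
    segment starts at \<open>- \<theta>\<close>; the path can be joined because the points
    agree.\<close>
  have end1: "of_real s * cis (- \<theta>) = of_real s * exp (\<i> * of_real (2 * pi - \<theta>))"
  proof -
    have "exp (\<i> * of_real (2 * pi - \<theta>)) = cis (2 * pi - \<theta>)" by (simp add: cis_conv_exp)
    also have "\<dots> = cis (- \<theta>)" by (simp add: complex_eq_iff sin_diff cos_diff)
    finally show ?thesis by simp
  qed
  have n1: "0 \<notin> path_image (linepath 1 (of_real s * cis \<theta>))" using pos[OF cos\<theta>] by auto
  have n3: "0 \<notin> path_image (linepath (of_real s * cis (- \<theta>)) 1)"
    using pos[of "- \<theta>"] cos\<theta> by (auto simp: closed_segment_commute)
  have n2: "0 \<notin> path_image (part_circlepath 0 s \<theta> (2 * pi - \<theta>))"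
    using s by (auto simp: path_image_part_circlepath')
  have n: "0 \<notin> path_image \<Gamma>"
    unfolding \<Gamma>_def using n1 n2 n3 end1 by (auto simp: path_image_join cis_conv_exp)
  have Ln: "Ln (of_real s * cis x) = of_real (ln s) + \<i> * of_real x" if "- pi < x" "x \<le> pi" for x
  proof -
    have "of_real s * cis x = exp (of_real (ln s) + \<i> * of_real x)"
      using s by (simp add: exp_add cis_conv_exp exp_of_real)
    then show ?thesis using that by simp
  qed
  have prim: "((\<lambda>w. 1 / w) has_contour_integral (Ln (pathfinish p) - Ln (pathstart p))) p"
    if "valid_path p" "path_image p \<subseteq> {z. Re z > 0}" for p
  proof (rule contour_integral_primitive[OF _ that])
    fix x :: complex assume "x \<in> {z. Re z > 0}"
    then have "x \<notin> \<real>\<^sub>\<le>\<^sub>0" by (auto simp: complex_nonpos_Reals_iff)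
    then show "(Ln has_field_derivative 1 / x) (at x within {z. Re z > 0})"
      by (metis has_field_derivative_Ln has_field_derivative_at_within inverse_eq_divide)
  qed
  have 1: "((\<lambda>w. 1 / w) has_contour_integral (of_real (ln s) + \<i> * of_real \<theta>)) (linepath 1 (of_real s * cis \<theta>))"
    using prim[of "linepath 1 (of_real s * cis \<theta>)"] pos[OF cos\<theta>] \<theta> by (simp add: Ln)
  have 3: "((\<lambda>w. 1 / w) has_contour_integral - (of_real (ln s) + \<i> * of_real (- \<theta>))) (linepath (of_real s * cis (- \<theta>)) 1)"
    using prim[of "linepath (of_real s * cis (- \<theta>)) 1"] pos[of "- \<theta>"] cos\<theta> \<theta> Ln[of "- \<theta>"]
    by (simp add: closed_segment_commute)
  have 2: "((\<lambda>w. 1 / w) has_contour_integral (\<i> * of_real (2 * pi - 2 * \<theta>))) (part_circlepath 0 s \<theta> (2 * pi - \<theta>))"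
    unfolding has_contour_integral_def
  proof (rule has_integral_eq)
    show "((\<lambda>x. \<i> * of_real (2 * pi - 2 * \<theta>)) has_integral \<i> * of_real (2 * pi - 2 * \<theta>)) {0..1::real}"
      using has_integral_const_real[of "\<i> * of_real (2 * pi - 2 * \<theta>)" 0 1] by simp
  next
    fix x :: real assume x: "x \<in> {0..1}"
    show "\<i> * of_real (2 * pi - 2 * \<theta>) = 1 / part_circlepath 0 s \<theta> (2 * pi - \<theta>) x *
      vector_derivative (part_circlepath 0 s \<theta> (2 * pi - \<theta>)) (at x within {0..1})"
      using s x by (subst vector_derivative_part_circlepath01) (auto simp: part_circlepath_def)
  qed
  have "((\<lambda>w. 1 / w) has_contour_integral ((of_real (ln s) + \<i> * of_real \<theta>) +
     ((\<i> * of_real (2 * pi - 2 * \<theta>)) + (- (of_real (ln s) + \<i> * of_real (- \<theta>)))))) \<Gamma>"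
    unfolding \<Gamma>_def using end1
    by (intro has_contour_integral_join 1 2 3 valid_path_join) auto
  then have "((\<lambda>w. 1 / w) has_contour_integral (2 * pi * \<i>)) \<Gamma>" by (simp add: algebra_simps)
  moreover have "valid_path \<Gamma>" unfolding \<Gamma>_def using end1 by (intro valid_path_join) (auto simp: cis_conv_exp)
  ultimately show "winding_number \<Gamma> 0 = 1"
    using n by (simp add: winding_number_valid_path contour_integral_unique)
qed

section \<open>Parametrised boundary arcs and their Cauchy formula\<close>

text \<open>Both segments start at the vertex for \<open>t = 0\<close>, so that \<open>t\<close>
  measures the distance to 1 as the locale demands. The third one therefore runs against the
  boundary orientation, which is corrected by a sign in the derivative.\<close>

definition edge :: "real \<Rightarrow> 3 \<Rightarrow> real \<Rightarrow> complex" where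
  "edge \<gamma> k = (if k = 1 then linepath 1 (of_real (sin \<gamma>) * cis (pi / 2 - \<gamma>))
    else if k = 2 then part_circlepath 0 (sin \<gamma>) (pi / 2 - \<gamma>) (3 * pi / 2 + \<gamma>)
    else linepath 1 (of_real (sin \<gamma>) * cis (\<gamma> - pi / 2)))"

definition edge_deriv :: "real \<Rightarrow> 3 \<Rightarrow> real \<Rightarrow> complex" where
  "edge_deriv \<gamma> k = (if k = 1 then (\<lambda>t. - of_real (cos \<gamma>) * cis (- \<gamma>))
    else if k = 2 then (\<lambda>t. \<i> * of_real (sin \<gamma>) * of_real (pi + 2 * \<gamma>) * exp (\<i> * of_real (linepath (pi / 2 - \<gamma>) (3 * pi / 2 + \<gamma>) t)))
    else (\<lambda>t. - of_real (cos \<gamma>) * cis \<gamma>))"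

lemma three_distinct: "(1::3) \<noteq> 2" "(2::3) \<noteq> 1" "(3::3) \<noteq> 1" "(3::3) \<noteq> 2"
  by simp_all

lemma edge_3_cases:
  obtains (1) "k = 1" | (2) "k = 2" | (3) "k = (3::3)"
  using exhaust_3 by blast

lemma edge_derivative: "(edge \<gamma> k has_vector_derivative edge_deriv \<gamma> k t) (at t within S)"
proof -
  have eq: "of_real (sin \<gamma>) * cis (pi / 2 - \<gamma>) - 1 = - of_real (cos \<gamma>) * cis (- \<gamma>)"
    "of_real (sin \<gamma>) * cis (\<gamma> - pi / 2) - 1 = - of_real (cos \<gamma>) * cis \<gamma>"
    using one_minus_tangent[of \<gamma>] by (simp_all add: algebra_simps)
  have *: "(linepath 1 b has_vector_derivative (b - 1)) (at t within S)" for b :: complex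
    by (rule has_vector_derivative_linepath_within)
  have arc: "of_real (3 * pi / 2 + \<gamma>) - of_real (pi / 2 - \<gamma>) = (of_real (pi + 2 * \<gamma>) :: complex)"
  proof -
    have "(3 * pi / 2 + \<gamma>) - (pi / 2 - \<gamma>) = pi + 2 * \<gamma>" by (simp add: field_simps)
    then show ?thesis by (simp only: of_real_diff[symmetric])
  qed
  show ?thesis
  proof (cases k rule: edge_3_cases)
    case 1
    then show ?thesis using *[of "of_real (sin \<gamma>) * cis (pi / 2 - \<gamma>)"] unfolding eq
      by (simp add: edge_def edge_deriv_def)
  next
    case 2
    then show ?thesis
      using has_vector_derivative_part_circlepath[of 0 "sin \<gamma>" "pi / 2 - \<gamma>" "3 * pi / 2 + \<gamma>" t S]
      unfolding edge_def edge_deriv_def arc by simp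
  next
    case 3
    then show ?thesis using *[of "of_real (sin \<gamma>) * cis (\<gamma> - pi / 2)"] unfolding eq
      by (simp add: edge_def edge_deriv_def)
  qed
qed

text \<open>Two readings of each segment: the polar form about the vertex serves
  \<open>edge_notin\<close> and \<open>edge_lower\<close>, the other one exhibits \<open>t\<close>
  as the weight \<open>l\<close> for \<open>edge_in_hull\<close>.\<close>

lemma edge_straight:
  "edge \<gamma> 1 t = 1 - of_real (t * cos \<gamma>) * cis (- \<gamma>)"
  "edge \<gamma> 1 t = 1 - of_real t + of_real (t * sin \<gamma>) * cis (pi / 2 - \<gamma>)"
  "edge \<gamma> 3 t = 1 - of_real (t * cos \<gamma>) * cis \<gamma>"
  "edge \<gamma> 3 t = 1 - of_real t + of_real (t * sin \<gamma>) * cis (\<gamma> - pi / 2)"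
proof -
  have l: "linepath 1 b t = 1 - of_real t + of_real t * b" "linepath 1 b t = 1 - of_real t * (1 - b)" for b :: complex
    by (simp_all add: linepath_def scaleR_conv_of_real algebra_simps)
  show "edge \<gamma> 1 t = 1 - of_real t + of_real (t * sin \<gamma>) * cis (pi / 2 - \<gamma>)"
    "edge \<gamma> 3 t = 1 - of_real t + of_real (t * sin \<gamma>) * cis (\<gamma> - pi / 2)"
    by (simp_all add: edge_def l(1))
  show "edge \<gamma> 1 t = 1 - of_real (t * cos \<gamma>) * cis (- \<gamma>)" "edge \<gamma> 3 t = 1 - of_real (t * cos \<gamma>) * cis \<gamma>"
    by (simp_all only: edge_def l(2) one_minus_tangent if_True if_False three_distinct simp_thms of_real_mult mult.assoc)
qed

lemma edge_arc: "edge \<gamma> 2 t = of_real (sin \<gamma>) * cis (linepath (pi / 2 - \<gamma>) (3 * pi / 2 + \<gamma>) t)"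
  by (simp add: edge_def part_circlepath_def cis_conv_exp)

lemma edge_in_hull:
  assumes \<gamma>: "0 < \<gamma>" "\<gamma> < pi / 2" and t: "0 \<le> t" "t \<le> 1"
  obtains l where "0 \<le> l" "l \<le> 1" "norm (1 - edge \<gamma> k t - of_real l) \<le> l * sin \<gamma>"
proof (cases k rule: edge_3_cases)
  case 1
  then show ?thesis using that[of t] t sin_pos_less_one[OF \<gamma>] by (simp add: edge_straight(2) norm_mult)
next
  case 2
  then show ?thesis using that[of 1] sin_pos_less_one[OF \<gamma>] by (simp add: edge_arc norm_mult)
next
  case 3
  then show ?thesis using that[of t] t sin_pos_less_one[OF \<gamma>] by (simp add: edge_straight(4) norm_mult)
qed

lemma edge_notin:
  assumes \<gamma>: "0 < \<gamma>" "\<gamma> < pi / 2" and t: "0 \<le> t" "t \<le> 1"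
  shows "edge \<gamma> k t \<notin> stolz \<gamma>"
proof -
  have c: "0 \<le> cos \<gamma>" using \<gamma> by (intro cos_ge_zero) auto
  show ?thesis
  proof (cases k rule: edge_3_cases)
    case 1
    then show ?thesis using edge_notin_stolz[OF \<gamma>, of "- \<gamma>" "t * cos \<gamma>"] t c by (simp only: edge_straight(1)) simp
  next
    case 2
    define x where "x = linepath (pi / 2 - \<gamma>) (3 * pi / 2 + \<gamma>) t"
    have x: "x = (pi / 2 - \<gamma>) + t * (pi + 2 * \<gamma>)" by (simp add: x_def linepath_def field_simps)
    have "t * (pi + 2 * \<gamma>) \<le> 1 * (pi + 2 * \<gamma>)" "0 \<le> t * (pi + 2 * \<gamma>)" using t \<gamma> by (auto intro!: mult_right_mono mult_nonneg_nonneg)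
    \<comment> \<open>Seen from \<open>pi\<close>, the angles of the arc reach out to
      \<open>pi / 2 + \<gamma>\<close>, where the cosine of the angle equals
      \<open>sin \<gamma>\<close>; this is the hypothesis of \<open>cis_notin_stolz\<close>.\<close>
    then have bd: "\<bar>x - pi\<bar> \<le> pi / 2 + \<gamma>" by (auto simp: x abs_le_iff)
    have "cos x = - cos (x - pi)" by (simp add: cos_diff)
    also have "cos (x - pi) = cos \<bar>x - pi\<bar>" by simp
    also have "- \<dots> \<le> - cos (pi / 2 + \<gamma>)" using bd \<gamma> by (intro le_imp_neg_le cos_monotone_0_pi_le) auto
    also have "- cos (pi / 2 + \<gamma>) = sin \<gamma>" by (simp add: cos_add)
    finally have "cos x \<le> sin \<gamma>" by simp
    then show ?thesis using 2 cis_notin_stolz[OF \<gamma>] by (simp add: edge_arc x_def)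
  next
    case 3
    then show ?thesis using edge_notin_stolz[OF \<gamma>, of \<gamma> "t * cos \<gamma>"] t c by (simp only: edge_straight(3)) simp
  qed
qed

text \<open>The distance to the vertex is \<open>t * cos \<gamma>\<close> on the segments and at
  least \<open>1 - sin \<gamma>\<close> on the arc, where \<open>t \<le> 1\<close> is
  enough.\<close>

lemma edge_lower:
  assumes \<gamma>: "0 < \<gamma>" "\<gamma> < pi / 2" and t: "0 \<le> t" "t \<le> 1"
  shows "min (cos \<gamma>) (1 - sin \<gamma>) * t \<le> norm (1 - edge \<gamma> k t)"
proof -
  have c: "0 \<le> cos \<gamma>" using \<gamma> by (intro cos_ge_zero) auto
  have "min (cos \<gamma>) (1 - sin \<gamma>) * t \<le> cos \<gamma> * t" using t by (intro mult_right_mono) auto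
  moreover have "min (cos \<gamma>) (1 - sin \<gamma>) * t \<le> (1 - sin \<gamma>) * 1"
    using t c sin_pos_less_one[OF \<gamma>] by (intro mult_mono) auto
  moreover have "1 - sin \<gamma> \<le> norm (1 - edge \<gamma> 2 t)"
    using norm_triangle_ineq2[of 1 "edge \<gamma> 2 t"] sin_pos_less_one[OF \<gamma>] by (simp add: edge_arc norm_mult)
  ultimately show ?thesis using t c
    by (cases k rule: edge_3_cases) (simp_all add: edge_straight(1,3) norm_mult mult.commute)
qed

lemma norm_edge_deriv:
  assumes \<gamma>: "0 < \<gamma>" "\<gamma> < pi / 2" shows "norm (edge_deriv \<gamma> k t) \<le> 2 * pi"
proof -
  have "0 \<le> cos \<gamma>" using \<gamma> by (intro cos_ge_zero) auto
  then have "\<bar>cos \<gamma>\<bar> \<le> 2 * pi" using cos_le_one[of \<gamma>] pi_ge_two by linarith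
  moreover have "sin \<gamma> * (pi + 2 * \<gamma>) \<le> 1 * (2 * pi)"
    using \<gamma> sin_pos_less_one[OF \<gamma>] by (intro mult_mono) auto
  then have "\<bar>sin \<gamma>\<bar> * \<bar>pi + 2 * \<gamma>\<bar> \<le> 2 * pi" using \<gamma> sin_pos_less_one[OF \<gamma>] by simp
  ultimately show ?thesis
    by (cases k rule: edge_3_cases) (simp_all add: edge_deriv_def norm_mult del: of_real_add of_real_mult)
qed

lemma edge_lipschitz:
  assumes \<gamma>: "0 < \<gamma>" "\<gamma> < pi / 2" shows "norm (edge \<gamma> k t - edge \<gamma> k u) \<le> 2 * pi * \<bar>t - u\<bar>"
proof -
  have "norm (edge \<gamma> k t - edge \<gamma> k u) \<le> 2 * pi * norm (t - u)"
  proof (rule differentiable_bound[OF convex_UNIV])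
    fix x show "(edge \<gamma> k has_derivative (\<lambda>h. h *\<^sub>R edge_deriv \<gamma> k x)) (at x)"
      using edge_derivative[of \<gamma> k x UNIV] by (simp add: has_vector_derivative_def)
    show "onorm (\<lambda>h. h *\<^sub>R edge_deriv \<gamma> k x) \<le> 2 * pi"
      using mult_left_mono[OF norm_edge_deriv[OF \<gamma>, of k x] abs_ge_zero]
      by (intro onorm_le) (simp add: mult.commute)
  qed auto
  then show ?thesis by simp
qed

lemma continuous_edge: "continuous_on S (edge \<gamma> k)" and continuous_edge_deriv: "continuous_on S (edge_deriv \<gamma> k)"
proof -
  show "continuous_on S (edge \<gamma> k)"
    using edge_derivative by (meson continuous_on_eq_continuous_within has_vector_derivative_continuous)
  show "continuous_on S (edge_deriv \<gamma> k)"
    by (cases k rule: edge_3_cases) (auto simp: edge_deriv_def linepath_def intro!: continuous_intros)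
qed

lemma edge_cauchy_formula:
  assumes \<gamma>: "0 < \<gamma>" "\<gamma> < \<beta>" "\<beta> < pi / 2" and r: "0 < r" "r < 1" and \<Phi>: "\<Phi> holomorphic_on stolz \<beta>"
    and \<zeta>: "\<zeta> \<in> stolz \<gamma>"
  shows "((\<lambda>t. \<Sum>k\<in>UNIV. \<Phi> (of_real r * edge \<gamma> k t) * ((if k = 3 then -1 else 1) * edge_deriv \<gamma> k t / (2 * pi * \<i>)) / (edge \<gamma> k t - \<zeta>))
    has_integral \<Phi> (of_real r * \<zeta>)) {0..1}"
proof -
  have \<gamma>': "\<gamma> < pi / 2" and \<beta>: "0 < \<beta>" using \<gamma> by auto
  have sin: "0 < sin \<gamma>" "sin \<gamma> < sin \<beta>"
    using sin_pos_less_one[OF \<gamma>(1) \<gamma>'] sin_monotone_2pi[of \<gamma> \<beta>] \<gamma> by auto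
  \<comment> \<open>Reversing the third edge gives the closed positively oriented boundary and
    explains the sign \<open>-1\<close> for \<open>k = 3\<close>.\<close>
  define \<Gamma> where "\<Gamma> = edge \<gamma> 1 +++ edge \<gamma> 2 +++ reversepath (edge \<gamma> 3)"
  define F where "F w = \<Phi> (of_real r * w) / (w - \<zeta>)" for w
  have valid: "valid_path (edge \<gamma> k)" for k by (cases k rule: edge_3_cases) (auto simp: edge_def)
  have ends: "pathstart (edge \<gamma> k) = edge \<gamma> k 0" "pathfinish (edge \<gamma> k) = edge \<gamma> k 1" for k
    by (simp_all add: pathstart_def pathfinish_def)
  have cis_end: "cis (3 * pi / 2 + \<gamma>) = cis (\<gamma> - pi / 2)"
  proof -
    have "3 * pi / 2 + \<gamma> = \<gamma> - pi / 2 + 2 * pi" by (simp add: field_simps)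
    moreover have "cis (\<gamma> - pi / 2 + 2 * pi) = cis (\<gamma> - pi / 2) * cis (2 * pi)" by (simp only: cis_mult)
    ultimately show ?thesis by simp
  qed
  have join: "edge \<gamma> 1 1 = edge \<gamma> 2 0" "edge \<gamma> 2 1 = edge \<gamma> 3 1" "edge \<gamma> 1 0 = 1" "edge \<gamma> 3 0 = 1"
    using cis_end by (simp_all add: edge_straight(2,4) edge_arc linepath_def)
  have valid\<Gamma>: "valid_path \<Gamma>"
    unfolding \<Gamma>_def using join ends valid by (intro valid_path_join) (auto simp: valid_path_imp_reverse)
  have closed: "pathfinish \<Gamma> = pathstart \<Gamma>" by (simp add: \<Gamma>_def ends join)
  have image: "\<exists>k t. 0 \<le> t \<and> t \<le> 1 \<and> u = edge \<gamma> k t" if u: "u \<in> path_image \<Gamma>" for u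
  proof -
    have "path_image \<Gamma> = path_image (edge \<gamma> 1) \<union> (path_image (edge \<gamma> 2) \<union> path_image (edge \<gamma> 3))"
      unfolding \<Gamma>_def using join ends by (simp add: path_image_join)
    then obtain k t where "t \<in> {0..1}" "u = edge \<gamma> k t" using u unfolding path_image_def by blast
    then show ?thesis by (intro exI[of _ k] exI[of _ t]) simp
  qed
  have disj: "stolz \<gamma> \<inter> path_image \<Gamma> = {}" using image edge_notin[OF \<gamma>(1) \<gamma>'] by blast
  have wn: "winding_number \<Gamma> \<zeta> = 1"
  proof -
    have eqs: "2 * pi - (pi / 2 - \<gamma>) = 3 * pi / 2 + \<gamma>" "- (pi / 2 - \<gamma>) = \<gamma> - pi / 2" by simp_all
    have "\<Gamma> = linepath 1 (of_real (sin \<gamma>) * cis (pi / 2 - \<gamma>)) +++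
        part_circlepath 0 (sin \<gamma>) (pi / 2 - \<gamma>) (3 * pi / 2 + \<gamma>) +++ linepath (of_real (sin \<gamma>) * cis (\<gamma> - pi / 2)) 1"
      by (simp add: \<Gamma>_def edge_def)
    then have "winding_number \<Gamma> 0 = 1"
      using stolz_boundary_winding_number[OF \<gamma>(1) \<gamma>'] unfolding eqs by simp
    \<comment> \<open>The connected set \<open>stolz \<gamma>\<close> contains both points and does
      not meet the curve.\<close>
    moreover have "winding_number \<Gamma> \<zeta> = winding_number \<Gamma> 0"
      using disj \<zeta> zero_in_stolz[OF \<gamma>(1) \<gamma>'] convex_stolz convex_connected valid\<Gamma> closed
      by (intro winding_number_eq[where S = "stolz \<gamma>"]) (auto simp: valid_path_imp_path)
    ultimately show ?thesis by simp
  qed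
  \<comment> \<open>The curve passes through the vertex, which is not in
    \<open>stolz \<beta>\<close>. The preimage under the dilation is open and convex and contains
    the whole curve, so the Cauchy formula for convex sets applies to
    \<open>\<lambda>w. \<Phi> (r * w)\<close>.\<close>
  define S where "S = (\<lambda>u. of_real r * u) -` stolz \<beta>"
  have "open S" unfolding S_def using open_stolz by (intro open_vimage continuous_intros)
  have "convex S"
    unfolding S_def by (intro convex_linear_vimage convex_stolz linear_times)
  have inS: "u \<in> S" if "0 \<le> l" "l \<le> 1" "norm (1 - u - of_real l) \<le> l * sin \<gamma>" for u l
    using stolz_scaled[OF \<beta> \<gamma>(3) sin that r] by (simp add: S_def)
  have "\<zeta> \<in> S"
  proof -
    obtain l where "0 < l" "l \<le> 1" "norm (1 - \<zeta> - of_real l) < l * sin \<gamma>"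
      using \<zeta> mem_stolz_iff[OF \<gamma>(1) \<gamma>'] by blast
    then show ?thesis using inS[of l \<zeta>] by auto
  qed
  have "path_image \<Gamma> \<subseteq> S"
  proof
    fix u assume "u \<in> path_image \<Gamma>"
    then obtain k t where "0 \<le> t" "t \<le> 1" and u: "u = edge \<gamma> k t" using image by blast
    then obtain l where "0 \<le> l" "l \<le> 1" "norm (1 - edge \<gamma> k t - of_real l) \<le> l * sin \<gamma>"
      using edge_in_hull[OF \<gamma>(1) \<gamma>'] by blast
    then show "u \<in> S" unfolding u by (rule inS)
  qed
  have "(F has_contour_integral (2 * pi * \<i> * winding_number \<Gamma> \<zeta> * \<Phi> (of_real r * \<zeta>))) \<Gamma>"
    unfolding F_def[abs_def]
  proof (rule Cauchy_integral_formula_convex_simple[OF \<open>convex S\<close>])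
    show "(\<lambda>w. \<Phi> (of_real r * w)) holomorphic_on S"
    proof -
      have "(\<lambda>w. of_real r * w) holomorphic_on S"
        by (intro holomorphic_on_mult holomorphic_on_const holomorphic_on_ident)
      moreover have "(\<lambda>w. of_real r * w) ` S \<subseteq> stolz \<beta>" unfolding S_def by blast
      ultimately show ?thesis using holomorphic_on_compose_gen[OF _ \<Phi>] unfolding o_def by blast
    qed
    show "\<zeta> \<in> interior S" using \<open>\<zeta> \<in> S\<close> \<open>open S\<close> by (simp add: interior_open)
    show "path_image \<Gamma> \<subseteq> S - {\<zeta>}" using \<open>path_image \<Gamma> \<subseteq> S\<close> disj \<zeta> by blast
  qed (use valid\<Gamma> closed in auto)
  then have C: "(F has_contour_integral (2 * pi * \<i> * \<Phi> (of_real r * \<zeta>))) \<Gamma>" by (simp add: wn)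
  then have "F contour_integrable_on \<Gamma>" by (auto simp: contour_integrable_on_def)
  then have int': "F contour_integrable_on edge \<gamma> 1" "F contour_integrable_on edge \<gamma> 2"
    "F contour_integrable_on reversepath (edge \<gamma> 3)"
    unfolding \<Gamma>_def using valid ends join by (simp_all add: valid_path_imp_reverse)
  then have int3: "F contour_integrable_on edge \<gamma> 3"
    using contour_integrable_reversepath[of "reversepath (edge \<gamma> 3)" F] valid by (simp add: valid_path_imp_reverse)
  have int: "F contour_integrable_on edge \<gamma> k" for k
    using int' int3 by (cases k rule: edge_3_cases) auto
  have "contour_integral \<Gamma> F = contour_integral (edge \<gamma> 1) F + (contour_integral (edge \<gamma> 2) F + contour_integral (reversepath (edge \<gamma> 3)) F)"
    unfolding \<Gamma>_def using int' valid ends join by (simp add: valid_path_imp_reverse)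
  then have I: "contour_integral (edge \<gamma> 1) F + contour_integral (edge \<gamma> 2) F - contour_integral (edge \<gamma> 3) F = 2 * pi * \<i> * \<Phi> (of_real r * \<zeta>)"
    using C valid by (simp add: contour_integral_unique contour_integral_reversepath)
  have hi: "((\<lambda>t. F (edge \<gamma> k t) * edge_deriv \<gamma> k t) has_integral contour_integral (edge \<gamma> k) F) {0..1}" for k
  proof -
    have vd: "vector_derivative (edge \<gamma> k) (at t within {0..1}) = edge_deriv \<gamma> k t" if "t \<in> {0..1}" for t
      using that edge_derivative[of \<gamma> k t UNIV] by (intro vector_derivative_at_within_ivl) auto
    have "((\<lambda>t. F (edge \<gamma> k t) * vector_derivative (edge \<gamma> k) (at t within {0..1}))
        has_integral contour_integral (edge \<gamma> k) F) {0..1}"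
      using has_contour_integral_integral[OF int[of k]] unfolding has_contour_integral_def .
    then show ?thesis by (rule has_integral_eq[rotated]) (simp add: vd)
  qed
  have hi': "((\<lambda>t. \<Phi> (of_real r * edge \<gamma> k t) * (c * edge_deriv \<gamma> k t / (2 * pi * \<i>)) / (edge \<gamma> k t - \<zeta>))
     has_integral (c / (2 * pi * \<i>) * contour_integral (edge \<gamma> k) F)) {0..1}" for k c
    using has_integral_mult_right[OF hi[of k], of "c / (2 * pi * \<i>)"] by (simp add: F_def mult_ac)
  have "((\<lambda>t. \<Sum>k\<in>UNIV. \<Phi> (of_real r * edge \<gamma> k t) * ((if k = 3 then -1 else 1) * edge_deriv \<gamma> k t / (2 * pi * \<i>)) / (edge \<gamma> k t - \<zeta>))
    has_integral (\<Sum>k\<in>UNIV. (if k = (3::3) then -1 else 1) / (2 * pi * \<i>) * contour_integral (edge \<gamma> k) F)) {0..1}"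
    by (intro has_integral_sum hi') auto
  also have "(\<Sum>k\<in>UNIV. (if k = (3::3) then -1 else 1) / (2 * pi * \<i>) * contour_integral (edge \<gamma> k) F)
    = (contour_integral (edge \<gamma> 1) F + contour_integral (edge \<gamma> 2) F - contour_integral (edge \<gamma> 3) F) / (2 * pi * \<i>)"
    unfolding sum_3 by (simp add: add_divide_distrib diff_divide_distrib)
  also have "\<dots> = \<Phi> (of_real r * \<zeta>)" unfolding I by simp
  finally show ?thesis .
qed

subsection \<open>Products of one-variable representations\<close>

text \<open>The countably many fibres of \<iota> partition the space, and finite sums of the fibre
  integrals of \<open>norm (F x)\<close> stay below its full integral. This gives an unordered sum
  over any countable index type, in particular over multi-indices.\<close>

lemma has_sum_integral_fibres:
  fixes F :: "'x \<Rightarrow> complex" and \<iota> :: "'x \<Rightarrow> 'i::countable"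
  assumes F: "integrable M F" and \<iota>: "\<And>i. {x \<in> space M. \<iota> x = i} \<in> sets M"
  shows "((\<lambda>i. \<integral>x. indicator {x. \<iota> x = i} x * F x \<partial>M) has_sum (\<integral>x. F x \<partial>M)) UNIV"
proof -
  \<comment> \<open>Coding the indices by \<open>to_nat\<close> reduces the claim to a series; codes
    that are not attained give empty fibres and are discarded at the end.\<close>
  define E where "E j = {x. to_nat (\<iota> x) = j}" for j
  define G where "G j x = indicator (E j) x * F x" for j x
  have E: "E j \<inter> space M \<in> sets M" for j
  proof (cases "j \<in> range (to_nat :: 'i \<Rightarrow> nat)")
    case True
    then obtain i :: 'i where "j = to_nat i" by auto
    then have "E j \<inter> space M = {x \<in> space M. \<iota> x = i}" by (auto simp: E_def)
    then show ?thesis using \<iota> by simp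
  next
    case False
    then have "E j = {}" by (auto simp: E_def)
    then show ?thesis by simp
  qed
  have G: "integrable M (G j)" for j
  proof -
    have "integrable M (\<lambda>x. indicator (E j \<inter> space M) x *\<^sub>R F x)"
      using F E by (intro integrable_mult_indicator)
    also have "?this \<longleftrightarrow> integrable M (G j)"
      by (intro Bochner_Integration.integrable_cong) (auto simp: G_def indicator_def)
    finally show ?thesis .
  qed
  have fin: "G j x = 0" if "j \<noteq> to_nat (\<iota> x)" for j x using that by (auto simp: G_def E_def)
  have le: "(\<Sum>j<n. norm (G j x)) \<le> norm (F x)" for n x
  proof -
    have "(\<Sum>j<n. norm (G j x)) = (\<Sum>j\<in>{..<n} \<inter> {to_nat (\<iota> x)}. norm (G j x))"
      by (intro sum.mono_neutral_right) (auto simp: fin)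
    also have "\<dots> \<le> norm (F x)" by (cases "to_nat (\<iota> x) < n") (auto simp: G_def E_def)
    finally show ?thesis .
  qed
  have "summable (\<lambda>j. \<integral>x. norm (G j x) \<partial>M)"
  proof (rule summableI_nonneg_bounded)
    show "(\<Sum>j<n. \<integral>x. norm (G j x) \<partial>M) \<le> (\<integral>x. norm (F x) \<partial>M)" for n
    proof -
      have "(\<Sum>j<n. \<integral>x. norm (G j x) \<partial>M) = (\<integral>x. (\<Sum>j<n. norm (G j x)) \<partial>M)"
        using G by (intro Bochner_Integration.integral_sum[symmetric] integrable_norm)
      also have "\<dots> \<le> (\<integral>x. norm (F x) \<partial>M)"
        using G F le by (intro integral_mono Bochner_Integration.integrable_sum integrable_norm)
      finally show ?thesis .
    qed
  qed auto
  moreover have "AE x in M. summable (\<lambda>j. norm (G j x))"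
    using fin by (intro always_eventually allI summable_finite[of "{to_nat (\<iota> x)}" for x]) auto
  moreover have suminf: "(\<Sum>j. G j x) = F x" for x
  proof -
    have "(\<Sum>j. G j x) = (\<Sum>j\<in>{to_nat (\<iota> x)}. G j x)" using fin by (intro suminf_finite) auto
    then show ?thesis by (simp add: G_def E_def)
  qed
  ultimately have "(\<lambda>j. integral\<^sup>L M (G j)) sums (\<integral>x. F x \<partial>M)"
    using sums_integral[of M G] G by simp
  moreover have "summable (\<lambda>j. norm (integral\<^sup>L M (G j)))"
    using \<open>summable (\<lambda>j. \<integral>x. norm (G j x) \<partial>M)\<close>
    by (rule summable_comparison_test'[where N = 0]) (auto intro: integral_norm_bound)
  ultimately have "((\<lambda>j. integral\<^sup>L M (G j)) has_sum (\<integral>x. F x \<partial>M)) UNIV"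
    by (intro norm_summable_imp_has_sum)
  also have "?this \<longleftrightarrow> ((\<lambda>j. integral\<^sup>L M (G j)) has_sum (\<integral>x. F x \<partial>M)) (range (to_nat :: 'i \<Rightarrow> nat))"
  proof (rule has_sum_cong_neutral)
    fix j assume "j \<in> UNIV - range (to_nat :: 'i \<Rightarrow> nat)"
    then have "G j = (\<lambda>_. 0)" using fin by blast
    then show "integral\<^sup>L M (G j) = 0" by simp
  qed auto
  also have "\<dots> \<longleftrightarrow> ((\<lambda>i. \<integral>x. indicator {x. \<iota> x = i} x * F x \<partial>M) has_sum (\<integral>x. F x \<partial>M)) UNIV"
    by (subst has_sum_reindex) (simp_all add: o_def G_def[abs_def] E_def)
  finally show ?thesis .
qed

text \<open>A slice is \<open>h\<close> composed with an affine map. Complex linearity of the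
  derivative turns its restriction to the axis into multiplication by \<open>L (axis k 1)\<close>, a
  complex derivative.\<close>

lemma holo_several_slice:
  fixes h :: "complex ^ 'n \<Rightarrow> complex"
  assumes h: "holo_several h {z. \<forall>k. z $ k \<in> B k}" and y: "\<And>j. y $ j \<in> B j" and B: "open (B k)"
  shows "(\<lambda>u. h (\<chi> j. if j = k then u else y $ j)) holomorphic_on B k"
proof -
  define s where "s u = axis k u + (\<chi> j. if j = k then 0 else y $ j)" for u :: complex
  have s: "(\<chi> j. if j = k then u else y $ j) = s u" for u
    by (simp add: s_def vec_eq_iff axis_def)
  have lin: "bounded_linear (axis k :: complex \<Rightarrow> complex ^ 'n)"
    unfolding linear_conv_bounded_linear[symmetric]
    by (intro linearI) (auto simp: vec_eq_iff axis_def)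
  have ds: "(s has_derivative axis k) (at u)" for u
    unfolding s_def using bounded_linear_imp_has_derivative[OF lin] by (auto intro!: derivative_eq_intros)
  have "(\<lambda>u. h (s u)) field_differentiable (at u)" if u: "u \<in> B k" for u
  proof -
    have "s u \<in> {z. \<forall>k. z $ k \<in> B k}" using u y by (auto simp flip: s)
    then obtain L where L: "(h has_derivative L) (at (s u))" "\<And>(c::complex) v. L (\<chi> j. c * v $ j) = c * L v"
      using h unfolding holo_several_def by blast
    have "((\<lambda>u. h (s u)) has_derivative (\<lambda>x. L (axis k x))) (at u)"
      using diff_chain_at[OF ds L(1)] by (simp add: o_def)
    moreover have "(\<lambda>x. L (axis k x)) = (*) (L (axis k 1))"
    proof
      fix x
      have "axis k x = (\<chi> j. x * (axis k 1 :: complex ^ 'n) $ j)" by (simp add: vec_eq_iff axis_def)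
      then show "L (axis k x) = L (axis k 1) * x" using L(2)[of x "axis k 1"] by (simp only: mult.commute)
    qed
    ultimately have "((\<lambda>u. h (s u)) has_field_derivative L (axis k 1)) (at u)"
      by (simp only: has_field_derivative_def)
    then show ?thesis by (auto simp: field_differentiable_def)
  qed
  then show ?thesis using B by (simp add: holomorphic_on_open s field_differentiable_def)
qed

lemma measurable_vec_lambda [measurable (raw)]:
  assumes "\<And>k. (\<lambda>x. g x k) \<in> borel_measurable M"
  shows "(\<lambda>x. (\<chi> k. g x k) :: complex ^ 'n) \<in> borel_measurable M"
proof (rule borel_measurable_euclidean_space[THEN iffD2], rule ballI)
  fix b :: "complex ^ 'n" assume "b \<in> Basis"
  then obtain k c where "b = axis k c" by (auto simp: Basis_vec_def)
  then show "(\<lambda>x. (\<chi> k. g x k) \<bullet> b) \<in> borel_measurable M" using assms by (simp add: inner_axis)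
qed

text \<open>A point evaluation of functions of one variable is an integral against \<open>f (\<iota> x) \<zeta> * \<phi> x\<close>
  along the map \<open>w\<close>; the fibres of \<open>\<iota>\<close> in the product measure give the coefficients.\<close>

lemma product_representation:
  fixes N :: "'x measure" and A B :: "'n::finite \<Rightarrow> complex set" and \<iota> :: "'x \<Rightarrow> nat"
    and \<phi> w :: "'n \<Rightarrow> 'x \<Rightarrow> complex" and f :: "'n \<Rightarrow> nat \<Rightarrow> complex \<Rightarrow> complex"
  assumes N: "sigma_finite_measure N" and \<iota>: "\<iota> \<in> measurable N (count_space UNIV)"
    and B: "\<And>k. open (B k)" and AB: "\<And>k. A k \<subseteq> B k"
    and w: "\<And>k. w k \<in> borel_measurable N" "\<And>k x. w k x \<in> B k"
    and \<phi>: "\<And>k i. integrable N (\<lambda>x. indicator {x. \<iota> x = i} x * \<phi> k x)"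
    and C: "\<And>k i. (\<integral>x. norm (indicator {x. \<iota> x = i} x * \<phi> k x) \<partial>N) \<le> C"
    and D: "\<And>k \<zeta>. \<zeta> \<in> A k \<Longrightarrow> integrable N (\<lambda>x. f k (\<iota> x) \<zeta> * \<phi> k x)"
    and rep: "\<And>k g \<zeta>. g holomorphic_on B k \<Longrightarrow> bounded (g ` B k) \<Longrightarrow> \<zeta> \<in> A k \<Longrightarrow>
      (\<integral>x. f k (\<iota> x) \<zeta> * \<phi> k x * g (w k x) \<partial>N) = g \<zeta>"
    and h: "holo_several h {z. \<forall>k. z $ k \<in> B k}" "bounded (h ` {z. \<forall>k. z $ k \<in> B k})"
  obtains a :: "('n \<Rightarrow> nat) \<Rightarrow> complex"
    where "\<And>i. norm (a i) \<le> C ^ CARD('n) * (SUP z\<in>{z. \<forall>k. z $ k \<in> B k}. norm (h z))"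
      and "\<And>\<zeta>. \<forall>k. \<zeta> $ k \<in> A k \<Longrightarrow> ((\<lambda>i. a i * (\<Prod>k\<in>UNIV. f k (i k) (\<zeta> $ k))) has_sum h \<zeta>) UNIV"
proof -
  interpret product_sigma_finite "\<lambda>_::'n. N" using N by (simp add: product_sigma_finite_def)
  define P where "P = {z :: complex ^ 'n. \<forall>k. z $ k \<in> B k}"
  define S where "S = (SUP z\<in>P. norm (h z))"
  have bdd: "bdd_above ((\<lambda>z. norm (h z)) ` P)"
    using h(2) by (auto simp: P_def bounded_iff bdd_above_def)
  have S: "norm (h z) \<le> S" if "z \<in> P" for z unfolding S_def using bdd that by (intro cSUP_upper)
  have contP: "continuous_on P h"
    using h(1) unfolding holo_several_def P_def
    by (intro continuous_at_imp_continuous_on ballI) (blast intro: has_derivative_continuous)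
  have "open P"
  proof -
    have "P = (\<Inter>k. (\<lambda>z. z $ k) -` B k)" by (auto simp: P_def)
    then show ?thesis using B by (auto intro!: open_INT open_vimage continuous_intros)
  qed
  \<comment> \<open>Extension by 0 is Borel measurable on the whole space, because \<open>P\<close>
    is open and \<open>h\<close> is continuous on it.\<close>
  define H where "H z = indicator P z *\<^sub>R h z" for z
  have [measurable]: "H \<in> borel_measurable borel"
    unfolding H_def using \<open>open P\<close> contP by (intro borel_measurable_continuous_on_indicator) auto
  note [measurable] = w(1) \<iota>
  have "P \<noteq> {}"
  proof -
    have "(\<chi> k. w k undefined) \<in> P" using w by (simp add: P_def)
    then show ?thesis by auto
  qed
  then have S0: "0 \<le> S" using S norm_ge_zero order_trans by (metis ex_in_conv)
  have HS: "norm (H z) \<le> S" for z using S[of z] S0 by (auto simp: H_def indicator_def)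
  \<comment> \<open>Coordinates in \<open>J\<close> are driven by the integration variables, the
    others are frozen at \<open>z\<close>; this sets up the induction over \<open>J\<close>.\<close>
  define pt where "pt J z x = (\<chi> k. if k \<in> J then w k (x k) else z $ k)" for J :: "'n set" and z :: "complex ^ 'n" and x
  have pt_P: "pt J z x \<in> P" if "z \<in> P" for J z x using that w by (auto simp: pt_def P_def)
  have pt_meas [measurable]: "pt J z \<in> measurable (PiM J (\<lambda>_. N)) borel" for J z
    unfolding pt_def
  proof (intro measurable_vec_lambda)
    fix k show "(\<lambda>x. if k \<in> J then w k (x k) else z $ k) \<in> borel_measurable (PiM J (\<lambda>_. N))"
      by (cases "k \<in> J") (simp_all, measurable)
  qed
  have int_prod: "integrable (PiM J (\<lambda>_. N)) (\<lambda>x. (\<Prod>k\<in>J. d k (x k)) * H (pt J z x))"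
    if "\<And>k. k \<in> J \<Longrightarrow> integrable N (d k)" for J d z
  proof (rule Bochner_Integration.integrable_bound)
    have *: "integrable (PiM J (\<lambda>_. N)) (\<lambda>x. (\<Prod>k\<in>J. d k (x k)))"
      using that by (intro product_integrable_prod) auto
    then show "integrable (PiM J (\<lambda>_. N)) (\<lambda>x. S * norm (\<Prod>k\<in>J. d k (x k)))" by simp
    have [measurable]: "(\<lambda>x. (\<Prod>k\<in>J. d k (x k))) \<in> borel_measurable (PiM J (\<lambda>_. N))"
      using * by auto
    show "(\<lambda>x. (\<Prod>k\<in>J. d k (x k)) * H (pt J z x)) \<in> borel_measurable (PiM J (\<lambda>_. N))"
      by measurable
    show "AE x in PiM J (\<lambda>_. N). norm ((\<Prod>k\<in>J. d k (x k)) * H (pt J z x)) \<le> norm (S * norm (\<Prod>k\<in>J. d k (x k)))"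
      using HS S0 by (auto simp: norm_mult mult.commute intro!: always_eventually mult_mono)
  qed
  define U where "U = (UNIV :: 'n set)"
  \<comment> \<open>For \<open>J = U\<close> all coordinates are overwritten; the point
    \<open>\<chi> k. w k undefined\<close> merely serves as some element of
    \<open>P\<close>.\<close>
  define a where "a i = (\<integral>x. (\<Prod>k\<in>U. indicator {x. \<iota> x = i k} (x k) * \<phi> k (x k)) * H (pt U (\<chi> k. w k undefined) x)
      \<partial>PiM U (\<lambda>_. N))" for i :: "'n \<Rightarrow> nat"
  have "norm (a i) \<le> C ^ CARD('n) * S" for i
  proof -
    let ?d = "\<lambda>k x. indicator {x. \<iota> x = i k} x * \<phi> k x"
    have "norm (a i) \<le> (\<integral>x. norm ((\<Prod>k\<in>U. ?d k (x k)) * H (pt U (\<chi> k. w k undefined) x)) \<partial>PiM U (\<lambda>_. N))"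
      unfolding a_def by (rule integral_norm_bound)
    also have "\<dots> \<le> (\<integral>x. (\<Prod>k\<in>U. norm (?d k (x k))) * S \<partial>PiM U (\<lambda>_. N))"
    proof (rule integral_mono)
      show "integrable (PiM U (\<lambda>_. N)) (\<lambda>x. norm ((\<Prod>k\<in>U. ?d k (x k)) * H (pt U (\<chi> k. w k undefined) x)))"
        using \<phi> by (intro integrable_norm int_prod)
      show "integrable (PiM U (\<lambda>_. N)) (\<lambda>x. (\<Prod>k\<in>U. norm (?d k (x k))) * S)"
        using \<phi> by (intro integrable_mult_left product_integrable_prod integrable_norm) (auto simp: U_def)
      show "norm ((\<Prod>k\<in>U. ?d k (x k)) * H (pt U (\<chi> k. w k undefined) x)) \<le> (\<Prod>k\<in>U. norm (?d k (x k))) * S" for x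
        unfolding norm_mult prod_norm[symmetric]
        using HS by (intro mult_left_mono) (auto intro!: prod_nonneg mult_nonneg_nonneg)
    qed
    also have "\<dots> = (\<Prod>k\<in>U. \<integral>x. norm (?d k x) \<partial>N) * S"
    proof -
      have "(\<integral>x. (\<Prod>k\<in>U. norm (?d k (x k))) \<partial>PiM U (\<lambda>_. N)) = (\<Prod>k\<in>U. \<integral>x. norm (?d k x) \<partial>N)"
        using \<phi> by (intro product_integral_prod integrable_norm) (auto simp: U_def)
      then show ?thesis by (simp only: integral_mult_left_zero)
    qed
    also have "\<dots> \<le> (\<Prod>k\<in>U. C) * S"
      using C S0 by (intro mult_right_mono prod_mono) auto
    finally show ?thesis by (simp add: U_def)
  qed
  moreover have "((\<lambda>i. a i * (\<Prod>k\<in>UNIV. f k (i k) (\<zeta> $ k))) has_sum h \<zeta>) UNIV"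
    if \<zeta>: "\<forall>k. \<zeta> $ k \<in> A k" for \<zeta>
  proof -
    let ?D = "\<lambda>k x. f k (\<iota> x) (\<zeta> $ k) * \<phi> k x"
    have ID: "integrable N (?D k)" for k using D \<zeta> by blast
    have "finite J \<Longrightarrow> z \<in> P \<Longrightarrow> (\<integral>x. (\<Prod>k\<in>J. ?D k (x k)) * H (pt J z x) \<partial>PiM J (\<lambda>_. N))
        = h (\<chi> k. if k \<in> J then \<zeta> $ k else z $ k)" for J z
    proof (induction J arbitrary: z rule: finite_induct)
      case empty
      show ?case using empty by (simp add: pt_def H_def PiM_empty lebesgue_integral_count_space_finite)
    next
      case (insert k J)
      \<comment> \<open>The new variable \<open>k\<close> is integrated first, by the one-variable
        formula for the slice of \<open>h\<close>; afterwards its coordinate is frozen at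
        \<open>\<zeta> $ k\<close>.\<close>
      define z' where "z' = (\<chi> j. if j = k then \<zeta> $ k else z $ j)"
      have z': "z' \<in> P" using insert.prems AB \<zeta> by (auto simp: z'_def P_def)
      have "(\<integral>x. (\<Prod>k\<in>insert k J. ?D k (x k)) * H (pt (insert k J) z x) \<partial>PiM (insert k J) (\<lambda>_. N)) =
        (\<integral>x. (\<integral>y. (\<Prod>j\<in>insert k J. ?D j ((x(k := y)) j)) * H (pt (insert k J) z (x(k := y))) \<partial>N) \<partial>PiM J (\<lambda>_. N))"
        using insert.hyps ID by (intro product_integral_insert int_prod)
      also have "\<dots> = (\<integral>x. (\<Prod>j\<in>J. ?D j (x j)) * H (pt J z' x) \<partial>PiM J (\<lambda>_. N))"
      proof (rule Bochner_Integration.integral_cong[OF refl])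
        fix x
        define y where "y = pt J z x"
        have y: "y \<in> P" using pt_P insert.prems by (simp add: y_def)
        define g where "g u = h (\<chi> j. if j = k then u else y $ j)" for u
        have g: "g holomorphic_on B k"
          unfolding g_def using y by (intro holo_several_slice h B) (auto simp: P_def)
        have inP: "(\<chi> j. if j = k then u else y $ j) \<in> P" if "u \<in> B k" for u
          using that y by (auto simp: P_def)
        have bg: "bounded (g ` B k)"
          unfolding bounded_iff g_def using S inP by blast
        have "(\<Prod>j\<in>insert k J. ?D j ((x(k := u)) j)) * H (pt (insert k J) z (x(k := u)))
          = (\<Prod>j\<in>J. ?D j (x j)) * (?D k u * g (w k u))" for u
        proof -
          have "(\<Prod>j\<in>J. ?D j ((x(k := u)) j)) = (\<Prod>j\<in>J. ?D j (x j))"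
            using insert.hyps by (intro prod.cong) auto
          moreover have "pt (insert k J) z (x(k := u)) = (\<chi> j. if j = k then w k u else y $ j)"
            using insert.hyps by (auto simp: pt_def y_def vec_eq_iff)
          moreover have "H (\<chi> j. if j = k then w k u else y $ j) = g (w k u)"
            using inP[of "w k u"] w by (simp add: H_def g_def)
          ultimately show ?thesis using insert.hyps by (simp add: mult_ac)
        qed
        then have "(\<integral>u. (\<Prod>j\<in>insert k J. ?D j ((x(k := u)) j)) * H (pt (insert k J) z (x(k := u))) \<partial>N)
          = (\<Prod>j\<in>J. ?D j (x j)) * (\<integral>u. ?D k u * g (w k u) \<partial>N)"
          by simp
        also have "(\<integral>u. ?D k u * g (w k u) \<partial>N) = g (\<zeta> $ k)" using rep g bg \<zeta> by blast
        also have "\<dots> = H (pt J z' x)"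
        proof -
          have "pt J z' x = (\<chi> j. if j = k then \<zeta> $ k else y $ j)"
            using insert.hyps by (auto simp: pt_def y_def z'_def vec_eq_iff)
          then show ?thesis using pt_P[OF z', of J x] by (simp add: g_def H_def)
        qed
        finally show "(\<integral>u. (\<Prod>j\<in>insert k J. ?D j ((x(k := u)) j)) * H (pt (insert k J) z (x(k := u))) \<partial>N)
          = (\<Prod>j\<in>J. ?D j (x j)) * H (pt J z' x)" .
      qed
      also have "\<dots> = h (\<chi> j. if j \<in> J then \<zeta> $ j else z' $ j)"
        using insert.IH z' by blast
      also have "(\<chi> j. if j \<in> J then \<zeta> $ j else z' $ j) = (\<chi> j. if j \<in> insert k J then \<zeta> $ j else z $ j)"
        by (auto simp: z'_def vec_eq_iff)
      finally show ?case .
    qed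
    from this[of U] have eq: "(\<integral>x. (\<Prod>k\<in>U. ?D k (x k)) * H (pt U (\<chi> k. w k undefined) x) \<partial>PiM U (\<lambda>_. N)) = h \<zeta>"
      using w by (simp add: U_def P_def)
    have "((\<lambda>i. \<integral>x. indicator {x. \<iota> \<circ> x = i} x * ((\<Prod>k\<in>U. ?D k (x k)) * H (pt U (\<chi> k. w k undefined) x)) \<partial>PiM U (\<lambda>_. N))
      has_sum h \<zeta>) UNIV"
      unfolding eq[symmetric]
    proof (rule has_sum_integral_fibres)
      show "integrable (PiM U (\<lambda>_. N)) (\<lambda>x. (\<Prod>k\<in>U. ?D k (x k)) * H (pt U (\<chi> k. w k undefined) x))"
        using ID by (intro int_prod)
      fix i :: "'n \<Rightarrow> nat"
      have "{x \<in> space (PiM U (\<lambda>_. N)). \<iota> \<circ> x = i} = {x \<in> space (PiM U (\<lambda>_. N)). \<forall>k\<in>U. \<iota> (x k) = i k}"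
        by (auto simp: fun_eq_iff U_def)
      also have "\<dots> \<in> sets (PiM U (\<lambda>_. N))"
        by measurable
      finally show "{x \<in> space (PiM U (\<lambda>_. N)). \<iota> \<circ> x = i} \<in> sets (PiM U (\<lambda>_. N))" .
    qed
    also have "(\<lambda>i. \<integral>x. indicator {x. \<iota> \<circ> x = i} x * ((\<Prod>k\<in>U. ?D k (x k)) * H (pt U (\<chi> k. w k undefined) x)) \<partial>PiM U (\<lambda>_. N))
      = (\<lambda>i. a i * (\<Prod>k\<in>UNIV. f k (i k) (\<zeta> $ k)))"
    proof
      fix i :: "'n \<Rightarrow> nat"
      \<comment> \<open>On the fibre of \<open>i\<close> the factors
        \<open>f k (\<iota> (x k)) (\<zeta> $ k)\<close> are constants and can leave the integral;
        off the fibre one of the indicators on the right vanishes.\<close>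
      have "indicator {x. \<iota> \<circ> x = i} x * (\<Prod>k\<in>U. ?D k (x k))
        = (\<Prod>k\<in>U. f k (i k) (\<zeta> $ k)) * (\<Prod>k\<in>U. indicator {x. \<iota> x = i k} (x k) * \<phi> k (x k))" for x
      proof (cases "\<iota> \<circ> x = i")
        case True
        then have "\<iota> (x k) = i k" for k by auto
        then show ?thesis using True by (simp add: prod.distrib)
      next
        case False
        then obtain k where "\<iota> (x k) \<noteq> i k" by (auto simp: fun_eq_iff)
        then have "(\<Prod>k\<in>U. indicator {x. \<iota> x = i k} (x k) * \<phi> k (x k)) = 0"
          by (intro prod_zero) (auto simp: U_def intro!: exI[of _ k])
        then show ?thesis using False by simp
      qed
      then have eq: "indicator {x. \<iota> \<circ> x = i} x * ((\<Prod>k\<in>U. ?D k (x k)) * H (pt U (\<chi> k. w k undefined) x))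
        = (\<Prod>k\<in>U. f k (i k) (\<zeta> $ k)) * ((\<Prod>k\<in>U. indicator {x. \<iota> x = i k} (x k) * \<phi> k (x k)) * H (pt U (\<chi> k. w k undefined) x))" for x
        unfolding mult.assoc[symmetric] by simp
      show "(\<integral>x. indicator {x. \<iota> \<circ> x = i} x * ((\<Prod>k\<in>U. ?D k (x k)) * H (pt U (\<chi> k. w k undefined) x)) \<partial>PiM U (\<lambda>_. N))
        = a i * (\<Prod>k\<in>UNIV. f k (i k) (\<zeta> $ k))"
        unfolding a_def eq integral_mult_right_zero U_def[symmetric] by (rule mult.commute)
    qed
    finally show ?thesis .
  qed
  ultimately show ?thesis using that[of a] by (simp add: S_def P_def)
qed

subsection \<open>Representing systems between two Stolz domains\<close>

lemma cauchy_arcs_exist: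
  assumes "0 < \<alpha>" "\<alpha> < \<beta>" "\<beta> < pi / 2"
  obtains \<kappa> c L q and z dz :: "3 \<Rightarrow> real \<Rightarrow> complex" where "cauchy_arcs \<alpha> \<beta> \<kappa> c L q z dz"
proof -
  define \<gamma> where "\<gamma> = (\<alpha> + \<beta>) / 2"
  have \<gamma>: "0 < \<gamma>" "\<alpha> < \<gamma>" "\<gamma> < \<beta>" "\<gamma> < pi / 2" and \<alpha>: "\<alpha> < pi / 2" and \<beta>: "0 < \<beta>"
    using assms by (auto simp: \<gamma>_def)
  obtain \<kappa> where \<kappa>: "0 < \<kappa>" "\<And>z \<zeta>. \<zeta> \<in> stolz \<alpha> \<Longrightarrow> z \<notin> stolz \<gamma> \<Longrightarrow> \<kappa> * (norm (1 - \<zeta>) + norm (1 - z)) \<le> norm (z - \<zeta>)"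
    using stolz_separation[OF assms(1) \<gamma>(2,4)] by blast
  define c where "c = min (cos \<gamma>) (1 - sin \<gamma>)"
  have sin: "0 < sin \<gamma>" "sin \<gamma> < 1" "sin \<gamma> < sin \<beta>"
    using sin_pos_less_one[OF \<gamma>(1,4)] sin_monotone_2pi[of \<gamma> \<beta>] \<gamma> assms by auto
  have "0 < cos \<gamma>" using \<gamma> by (intro cos_gt_zero) auto
  then have c: "0 < c" "c \<le> 1" using sin by (auto simp: c_def)
  define L where "L = 2 * pi"
  have L: "0 < L" by (simp add: L_def)
  \<comment> \<open>The second term of the minimum yields
    \<open>L * (1 - q) \<le> \<kappa> * c / 2\<close>, and the bound 1/2 keeps \<open>q\<close>
    positive.\<close>
  define q where "q = 1 - min (1 / 2) (\<kappa> * c / (2 * L))"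
  have q: "0 < q" "q < 1" using \<kappa> c L by (auto simp: q_def)
  have "L * (1 - q) \<le> L * (\<kappa> * c / (2 * L))" unfolding q_def using L by (intro mult_left_mono) auto
  then have qL: "L * (1 - q) \<le> \<kappa> * c / 2" using L by simp
  define dz where "dz k t = (if k = 3 then -1 else 1) * edge_deriv \<gamma> k t / (2 * pi * \<i>)" for k :: 3 and t
  have lower: "c * t \<le> norm (1 - edge \<gamma> k t)" if "0 < t" "t \<le> 1" for k t
    unfolding c_def using edge_lower[OF \<gamma>(1,4)] that by auto
  have notin: "edge \<gamma> k t \<notin> stolz \<gamma>" if "0 < t" "t \<le> 1" for k t
    using edge_notin[OF \<gamma>(1,4)] that by auto
  have inn: "edge \<gamma> k t \<in> stolz \<beta>" if t: "0 < t" "t \<le> 1" for k t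
  proof -
    have "0 < c * t" using c t by simp
    then have "edge \<gamma> k t \<noteq> 1" using lower[OF t, of k] by auto
    moreover obtain l where "0 \<le> l" "l \<le> 1" "norm (1 - edge \<gamma> k t - of_real l) \<le> l * sin \<gamma>"
      using edge_in_hull[OF \<gamma>(1,4), of t k] t by auto
    ultimately show ?thesis using stolz_closed_hull[OF \<beta> assms(3) sin(1,3)] by blast
  qed
  have dz_bound: "norm (dz k t) \<le> L" for k t
  proof -
    have "norm (dz k t) = norm (edge_deriv \<gamma> k t) / (2 * pi)" by (simp add: dz_def norm_divide norm_mult)
    also have "\<dots> \<le> 1" using norm_edge_deriv[OF \<gamma>(1,4), of k t] by (simp add: divide_simps)
    also have "\<dots> \<le> L" using pi_ge_two by (simp add: L_def)
    finally show ?thesis .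
  qed
  have dz_cont: "continuous_on S (dz k)" for S k
    unfolding dz_def by (intro continuous_intros continuous_edge_deriv) auto
  have "cauchy_arcs \<alpha> \<beta> \<kappa> c L q (edge \<gamma>) dz"
  proof
    show "\<kappa> * (norm (1 - \<zeta>) + norm (1 - edge \<gamma> k t)) \<le> norm (edge \<gamma> k t - \<zeta>)"
      if "0 < t" "t \<le> 1" "\<zeta> \<in> stolz \<alpha>" for k t \<zeta> using \<kappa>(2) notin that by blast
    show "norm (edge \<gamma> k t' - edge \<gamma> k t) \<le> L * (t' - t)" if "0 < t" "t \<le> t'" "t' \<le> 1" for k t t'
      using edge_lipschitz[OF \<gamma>(1,4), of k t' t] that by (simp add: L_def)
    fix g \<zeta> assume g: "g holomorphic_on stolz \<beta>" "bounded (g ` stolz \<beta>)" and \<zeta>: "\<zeta> \<in> stolz \<alpha>"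
    have "1 - \<zeta> \<noteq> 0" using stolz_bounds(1)[OF assms(1) \<alpha> \<zeta>] by auto
    have \<zeta>\<gamma>: "\<zeta> \<in> stolz \<gamma>" using \<zeta> stolz_mono[of \<alpha> \<gamma>] \<gamma> assms by auto
    then have \<zeta>\<beta>: "\<zeta> \<in> stolz \<beta>" using stolz_mono[of \<gamma> \<beta>] \<gamma> assms by auto
    show "(\<integral>t. indicator {0<..1} t *\<^sub>R
        (\<Sum>k\<in>UNIV. g (edge \<gamma> k t) * (csqrt (1 - \<zeta>) / csqrt (1 - edge \<gamma> k t)) * dz k t / (edge \<gamma> k t - \<zeta>)) \<partial>lborel) = g \<zeta>"
    \<comment> \<open>In the limit \<zeta> is fixed, so the separation from the arcs may be replaced
      by the constant \<open>\<kappa> * norm (1 - \<zeta>)\<close>.\<close>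
    proof (rule cauchy_formula_limit[where \<kappa> = "\<kappa> * norm (1 - \<zeta>)" and c = c and L = L])
      show "\<kappa> * norm (1 - \<zeta>) \<le> norm (edge \<gamma> k t - \<zeta>)" if "0 < t" "t \<le> 1" for k t
      proof -
        have "\<kappa> * norm (1 - \<zeta>) \<le> \<kappa> * (norm (1 - \<zeta>) + norm (1 - edge \<gamma> k t))"
          using \<kappa> by (intro mult_left_mono) auto
        also have "\<dots> \<le> norm (edge \<gamma> k t - \<zeta>)" using \<kappa>(2) notin that \<zeta> by blast
        finally show ?thesis .
      qed
      show "of_real r * u \<in> stolz \<beta>" if "0 < r" "r < 1" "u \<in> stolz \<beta>" for r u
        using convexD_alt[OF convex_stolz zero_in_stolz[OF \<beta> assms(3)] that(3), of r] that
        by (simp add: scaleR_conv_of_real)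
      show "((\<lambda>t. \<Sum>k\<in>UNIV. \<Phi> (of_real r * edge \<gamma> k t) * dz k t / (edge \<gamma> k t - \<zeta>)) has_integral \<Phi> (of_real r * \<zeta>)) {0..1}"
        if "0 < r" "r < 1" "\<Phi> holomorphic_on stolz \<beta>" for r \<Phi>
        unfolding dz_def using edge_cauchy_formula[OF \<gamma>(1,3) assms(3) that \<zeta>\<gamma>] .
      show "0 < \<kappa> * norm (1 - \<zeta>)" using \<kappa> \<open>1 - \<zeta> \<noteq> 0\<close> by simp
    qed (use \<beta> assms(3) c(1) L \<zeta>\<beta> lower inn continuous_edge dz_cont dz_bound g in auto)
  qed (use assms \<alpha> \<beta> \<kappa>(1) c L q qL lower inn continuous_edge dz_cont dz_bound in auto)
  then show ?thesis by (rule that)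
qed

section \<open>The index measure and the choice of the systems\<close>

lemma indicator_singleton_sums:
  fixes y :: "'b :: real_normed_field"
  shows "(\<lambda>j. indicator {i} j * y) sums y" "summable (\<lambda>j :: nat. norm (indicator {i} j * y))"
proof -
  have "(\<lambda>j. indicator {i} j * y) = (\<lambda>j. if j = i then y else 0)" by (auto simp: fun_eq_iff)
  then show "(\<lambda>j. indicator {i} j * y) sums y" using sums_single[of i "\<lambda>_. y"] by simp
  show "summable (\<lambda>j. norm (indicator {i} j * y))"
    by (rule summable_finite[of "{i}"]) auto
qed

text \<open>On \<open>index_measure\<close> the fibre over \<open>i\<close> is a copy of the real
  line, so fibre integrals are the Lebesgue integrals already estimated.\<close>

lemma integral_slice:
  fixes \<psi> :: "real \<Rightarrow> 'b :: {real_normed_field, banach, second_countable_topology}"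
  assumes \<psi>: "integrable lborel \<psi>"
  shows "integrable (count_space (UNIV :: nat set) \<Otimes>\<^sub>M lborel) (\<lambda>x. indicator {i} (fst x) * \<psi> (snd x))"
    and "(\<integral>x. indicator {i} (fst x) * \<psi> (snd x) \<partial>(count_space (UNIV :: nat set) \<Otimes>\<^sub>M lborel)) = (\<integral>t. \<psi> t \<partial>lborel)"
proof -
  interpret pair_sigma_finite "count_space (UNIV :: nat set)" "lborel :: real measure"
    by (intro pair_sigma_finite.intro sigma_finite_measure_count_space_countable sigma_finite_lborel) auto
  have [measurable]: "\<psi> \<in> borel_measurable lborel" using \<psi> by auto
  show int: "integrable (count_space (UNIV :: nat set) \<Otimes>\<^sub>M lborel) (\<lambda>x. indicator {i} (fst x) * \<psi> (snd x))"
  proof (rule Fubini_integrable)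
    show "(\<lambda>x. indicator {i} (fst x) * \<psi> (snd x)) \<in> borel_measurable (count_space (UNIV :: nat set) \<Otimes>\<^sub>M lborel)"
      by (rule measurable_pair_measure_countable1) auto
    show "integrable (count_space UNIV) (\<lambda>j. \<integral>t. norm (indicator {i} (fst (j, t)) * \<psi> (snd (j, t))) \<partial>lborel)"
      unfolding integrable_count_space_nat_iff
      by (rule summable_finite[of "{i}"]) (simp_all add: indicator_def)
  qed (use \<psi> in auto)
  have "(\<integral>x. indicator {i} (fst x) * \<psi> (snd x) \<partial>(count_space (UNIV :: nat set) \<Otimes>\<^sub>M lborel))
    = (\<integral>j. indicator {i} j * (\<integral>t. \<psi> t \<partial>lborel) \<partial>count_space UNIV)"
    using integral_fst'[OF int] by simp
  also have "\<dots> = (\<Sum>j. indicator {i} j * (\<integral>t. \<psi> t \<partial>lborel))"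
    by (rule integral_count_space_nat) (simp only: integrable_count_space_nat_iff indicator_singleton_sums)
  also have "\<dots> = (\<integral>t. \<psi> t \<partial>lborel)"
    by (rule sums_unique[OF indicator_singleton_sums(1), symmetric])
  finally show "(\<integral>x. indicator {i} (fst x) * \<psi> (snd x) \<partial>(count_space (UNIV :: nat set) \<Otimes>\<^sub>M lborel)) = (\<integral>t. \<psi> t \<partial>lborel)" .
qed

abbreviation index_measure :: "(nat \<times> real) measure" where
  "index_measure \<equiv> count_space UNIV \<Otimes>\<^sub>M lborel"

text \<open>Collects all that one variable must supply to \<open>product_representation\<close>, so
  that the objects for all \<open>k\<close> can be chosen at once. The square is the product of the
  two equal factors of the theorem. Only the functions depend on the angles; the measure and the
  index map \<open>fst\<close> are common to all variables, as a power of one measure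
  requires.\<close>

definition stolz_system ::
    "real \<Rightarrow> real \<Rightarrow> (nat \<Rightarrow> complex \<Rightarrow> complex) \<Rightarrow> (nat \<times> real \<Rightarrow> complex) \<Rightarrow> (nat \<times> real \<Rightarrow> complex) \<Rightarrow> real \<Rightarrow> bool" where
  "stolz_system \<alpha> \<beta> \<Psi> \<phi> w C \<longleftrightarrow>
    (\<forall>i. \<Psi> i \<in> Hinf0 (stolz \<alpha>)) \<and>
    (\<forall>p>0. \<exists>M. \<forall>\<zeta>\<in>stolz \<alpha>. summable (\<lambda>i. norm (\<Psi> i \<zeta>) powr p) \<and> (\<Sum>i. norm (\<Psi> i \<zeta>) powr p) \<le> M) \<and>
    w \<in> borel_measurable index_measure \<and> (\<forall>x. w x \<in> stolz \<beta>) \<and>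
    (\<forall>i. integrable index_measure (\<lambda>x. indicator {x. fst x = i} x * \<phi> x) \<and>
      (\<integral>x. norm (indicator {x. fst x = i} x * \<phi> x) \<partial>index_measure) \<le> C) \<and>
    (\<forall>\<zeta>\<in>stolz \<alpha>. integrable index_measure (\<lambda>x. \<Psi> (fst x) \<zeta> ^ 2 * \<phi> x) \<and>
      (\<forall>g. g holomorphic_on stolz \<beta> \<and> bounded (g ` stolz \<beta>) \<longrightarrow>
        (\<integral>x. \<Psi> (fst x) \<zeta> ^ 2 * \<phi> x * g (w x) \<partial>index_measure) = g \<zeta>))"

lemma stolz_system_exists:
  assumes "0 < \<alpha>" "\<alpha> < \<beta>" "\<beta> < pi / 2"
  shows "\<exists>\<Psi> \<phi> w C. stolz_system \<alpha> \<beta> \<Psi> \<phi> w C"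
proof -
  obtain \<kappa> c L q and z dz :: "3 \<Rightarrow> real \<Rightarrow> complex" where "cauchy_arcs \<alpha> \<beta> \<kappa> c L q z dz"
    using cauchy_arcs_exist[OF assms] by blast
  then interpret cauchy_arcs \<alpha> \<beta> \<kappa> c L q z dz .
  have inf: "infinite (UNIV :: (3 \<times> nat \<times> nat) set)" by (simp add: finite_prod)
  obtain e :: "nat \<Rightarrow> 3 \<times> nat \<times> nat" where e: "bij e"
    using bij_betw_from_nat_into[OF _ inf] by auto
  have "\<exists>g. g holomorphic_on stolz \<alpha> \<and> (\<forall>\<zeta>\<in>stolz \<alpha>. f i \<zeta> = g \<zeta> ^ 2)" for i
    using f_sqrt[of i] by metis
  then obtain G where G: "\<And>i. G i holomorphic_on stolz \<alpha>" "\<And>i \<zeta>. \<zeta> \<in> stolz \<alpha> \<Longrightarrow> f i \<zeta> = G i \<zeta> ^ 2"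
    by metis
  have normG: "norm (G i \<zeta>) = sqrt (norm (f i \<zeta>))" if "\<zeta> \<in> stolz \<alpha>" for i \<zeta>
    using G(2)[OF that, of i] by (simp add: norm_power)
  define \<Psi> where "\<Psi> j = G (e j)" for j
  define \<phi>' where "\<phi>' x = \<phi> (e (fst x)) (snd x)" for x
  define w' where "w' x = w (e (fst x)) (snd x)" for x
  have "G i \<in> Hinf0 (stolz \<alpha>)" for i
  proof -
    obtain s n m where i: "i = (s, n, m)" by (cases i)
    define K where "K = sqrt (sqrt (q ^ n) / (2 * R n))"
    have K: "K > 0" using qn[of n] q R_pos[of n] by (simp add: K_def)
    \<comment> \<open>The exponent 1/2 of \<open>f i\<close> at the vertex is halved by the square
      root.\<close>
    have le: "norm (G i \<zeta>) \<le> K * norm (1 - \<zeta>) powr (1 / 4)" if \<zeta>: "\<zeta> \<in> stolz \<alpha>" for \<zeta>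
    proof -
      have "norm (G i \<zeta>) \<le> sqrt (sqrt (q ^ n) / (2 * R n) * sqrt (norm (1 - \<zeta>)))"
        unfolding normG[OF \<zeta>] i using norm_f_le_sqrt[OF \<zeta>] by simp
      also have "\<dots> = K * sqrt (sqrt (norm (1 - \<zeta>)))" by (simp only: K_def real_sqrt_mult)
      also have "sqrt (sqrt (norm (1 - \<zeta>))) = norm (1 - \<zeta>) powr (1 / 4)"
        by (simp add: powr_half_sqrt[symmetric] powr_powr)
      finally show ?thesis .
    qed
    have "norm (G i \<zeta>) \<le> K * 2 powr (1 / 4)" if \<zeta>: "\<zeta> \<in> stolz \<alpha>" for \<zeta>
      using le[OF \<zeta>] stolz_bounds(2)[OF \<alpha> \<zeta>] K
      by (elim order_trans) (auto intro!: mult_left_mono powr_mono2)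
    then have "bounded (G i ` stolz \<alpha>)" by (auto simp: bounded_iff)
    moreover have "\<exists>c s. c > 0 \<and> s > 0 \<and> (\<forall>z\<in>stolz \<alpha>. norm (G i z) \<le> c * norm (1 - z) powr s)"
      using le K by (intro exI[of _ K] exI[of _ "1/4"]) auto
    ultimately show ?thesis using G(1) by (simp add: Hinf0_def)
  qed
  moreover have "\<exists>M. \<forall>\<zeta>\<in>stolz \<alpha>. summable (\<lambda>i. norm (\<Psi> i \<zeta>) powr p) \<and> (\<Sum>i. norm (\<Psi> i \<zeta>) powr p) \<le> M"
    if p: "p > 0" for p
  proof -
    \<comment> \<open>An exponent \<open>p\<close> for \<Psi> is the exponent \<open>p / 2\<close>
      for \<open>f\<close>.\<close>
    obtain M where M: "\<And>\<zeta> S. \<zeta> \<in> stolz \<alpha> \<Longrightarrow> finite S \<Longrightarrow> (\<Sum>i\<in>S. norm (f i \<zeta>) powr (p / 2)) \<le> M"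
      using sum_f_bound[of "p / 2"] p by auto
    have le: "(\<Sum>j<n. norm (\<Psi> j \<zeta>) powr p) \<le> M" if \<zeta>: "\<zeta> \<in> stolz \<alpha>" for n \<zeta>
    proof -
      have "(\<Sum>j<n. norm (\<Psi> j \<zeta>) powr p) = (\<Sum>j<n. norm (f (e j) \<zeta>) powr (p / 2))"
        unfolding \<Psi>_def normG[OF \<zeta>] by (simp add: powr_half_sqrt[symmetric] powr_powr)
      also have "\<dots> = (\<Sum>i\<in>e ` {..<n}. norm (f i \<zeta>) powr (p / 2))"
        using e by (subst sum.reindex) (auto simp: bij_def inj_on_def)
      also have "\<dots> \<le> M" using M[OF \<zeta>] by simp
      finally show ?thesis .
    qed
    then have "summable (\<lambda>i. norm (\<Psi> i \<zeta>) powr p)" if "\<zeta> \<in> stolz \<alpha>" for \<zeta>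
      using that by (intro summableI_nonneg_bounded) auto
    then show ?thesis using le by (intro exI[of _ M]) (auto intro: suminf_le_const)
  qed
  moreover have "w' \<in> borel_measurable index_measure"
    unfolding w'_def by (rule measurable_pair_measure_countable1) auto
  moreover have "integrable index_measure (\<lambda>x. indicator {x. fst x = i} x * \<phi>' x)"
    "(\<integral>x. norm (indicator {x. fst x = i} x * \<phi>' x) \<partial>index_measure) \<le> L / sqrt (c * q)" for i
  proof -
    have eq: "indicator {x. fst x = i} x * \<phi>' x = indicator {i} (fst x) * \<phi> (e i) (snd x)" for x
      by (auto simp: \<phi>'_def indicator_def)
    then show "integrable index_measure (\<lambda>x. indicator {x. fst x = i} x * \<phi>' x)"
      using integral_slice(1)[OF integrable_phi(1), of i "e i"] by simp
    have "norm (indicator {x. fst x = i} x * \<phi>' x) = indicator {i} (fst x) * norm (\<phi> (e i) (snd x))" for x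
      unfolding eq norm_mult by (simp add: indicator_def)
    then show "(\<integral>x. norm (indicator {x. fst x = i} x * \<phi>' x) \<partial>index_measure) \<le> L / sqrt (c * q)"
      using integral_slice(2)[OF integrable_norm[OF integrable_phi(1)], of i "e i"] integrable_phi(2)[of "e i"] by simp
  qed
  \<comment> \<open>The representation with \<open>g\<close> the constant 1.\<close>
  moreover have "integrable index_measure (\<lambda>x. \<Psi> (fst x) \<zeta> ^ 2 * \<phi>' x)" if \<zeta>: "\<zeta> \<in> stolz \<alpha>" for \<zeta>
    using integral_representation(1)[OF e \<zeta>, of "\<lambda>_. 1"] by (simp add: \<Psi>_def \<phi>'_def G(2)[OF \<zeta>] image_constant_conv)
  moreover have "(\<integral>x. \<Psi> (fst x) \<zeta> ^ 2 * \<phi>' x * g (w' x) \<partial>index_measure) = g \<zeta>"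
    if \<zeta>: "\<zeta> \<in> stolz \<alpha>" and g: "g holomorphic_on stolz \<beta>" "bounded (g ` stolz \<beta>)" for \<zeta> g
    using integral_representation(2)[OF e \<zeta> g] by (simp add: \<Psi>_def \<phi>'_def w'_def G(2)[OF \<zeta>])
  ultimately have "stolz_system \<alpha> \<beta> \<Psi> \<phi>' w' (L / sqrt (c * q))"
    unfolding stolz_system_def by (auto simp: \<Psi>_def w'_def w_in)
  then show ?thesis by blast
qed

theorem theorem6p1:
  fixes \<alpha> \<beta> :: "'n::finite \<Rightarrow> real"
  assumes "\<And>k. 0 < \<beta> k \<and> \<beta> k < pi / 2"
      and "\<And>k. 0 < \<alpha> k \<and> \<alpha> k < \<beta> k"
  shows "\<exists>(\<Psi> :: 'n \<Rightarrow> nat \<Rightarrow> complex \<Rightarrow> complex) (\<Psi>t :: 'n \<Rightarrow> nat \<Rightarrow> complex \<Rightarrow> complex).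
     (\<forall>k i. \<Psi> k i \<in> Hinf0 (stolz (\<alpha> k)) \<and> \<Psi>t k i \<in> Hinf0 (stolz (\<alpha> k))) \<and>
     (\<forall>p::real. p > 0 \<longrightarrow> (\<forall>k. \<exists>M. \<forall>\<zeta>\<in>stolz (\<alpha> k).
         summable (\<lambda>i. norm (\<Psi> k i \<zeta>) powr p) \<and> (\<Sum>i. norm (\<Psi> k i \<zeta>) powr p) \<le> M \<and>
         summable (\<lambda>i. norm (\<Psi>t k i \<zeta>) powr p) \<and> (\<Sum>i. norm (\<Psi>t k i \<zeta>) powr p) \<le> M)) \<and>
     (\<exists>C>0. \<forall>h :: complex ^ 'n \<Rightarrow> complex.
        holo_several h {z. \<forall>k. z $ k \<in> stolz (\<beta> k)} \<and>
        bounded (h ` {z. \<forall>k. z $ k \<in> stolz (\<beta> k)}) \<longrightarrow>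
        (\<exists>a :: ('n \<Rightarrow> nat) \<Rightarrow> complex.
           (\<forall>i. norm (a i) \<le> C * (SUP z\<in>{z. \<forall>k. z $ k \<in> stolz (\<beta> k)}. norm (h z))) \<and>
           (\<forall>\<zeta>. (\<forall>k. \<zeta> $ k \<in> stolz (\<alpha> k)) \<longrightarrow>
              ((\<lambda>i. a i * (\<Prod>k\<in>UNIV. \<Psi> k (i k) (\<zeta> $ k) * \<Psi>t k (i k) (\<zeta> $ k))) has_sum h \<zeta>) UNIV)))"
proof -
  have "\<exists>\<Psi> \<phi> w C. stolz_system (\<alpha> k) (\<beta> k) \<Psi> \<phi> w C" for k
    using assms stolz_system_exists by blast
  then obtain \<Psi> \<phi> w C where sys: "\<And>k. stolz_system (\<alpha> k) (\<beta> k) (\<Psi> k) (\<phi> k) (w k) (C k)" by metis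
  note sys = sys[unfolded stolz_system_def]
  \<comment> \<open>A positive bound common to all variables; its power \<open>K ^ CARD('n)\<close>
    becomes the constant of the theorem.\<close>
  define K where "K = 1 + (\<Sum>k\<in>UNIV. \<bar>C k\<bar>)"
  have K: "0 < K" by (simp add: K_def sum_nonneg add_pos_nonneg)
  have CK: "C k \<le> K" for k
    using member_le_sum[of k UNIV "\<lambda>k. \<bar>C k\<bar>"] by (simp add: K_def)
  show ?thesis
  proof (intro exI[of _ \<Psi>] conjI allI impI)
    show "\<Psi> k i \<in> Hinf0 (stolz (\<alpha> k))" "\<Psi> k i \<in> Hinf0 (stolz (\<alpha> k))" for k i
      using sys by blast+
  next
    fix p :: real and k assume "p > 0"
    then show "\<exists>M. \<forall>\<zeta>\<in>stolz (\<alpha> k). summable (\<lambda>i. norm (\<Psi> k i \<zeta>) powr p) \<and> (\<Sum>i. norm (\<Psi> k i \<zeta>) powr p) \<le> M \<and>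
         summable (\<lambda>i. norm (\<Psi> k i \<zeta>) powr p) \<and> (\<Sum>i. norm (\<Psi> k i \<zeta>) powr p) \<le> M"
      using sys[of k] by meson
  next
    show "\<exists>C>0. \<forall>h :: complex ^ 'n \<Rightarrow> complex.
        holo_several h {z. \<forall>k. z $ k \<in> stolz (\<beta> k)} \<and>
        bounded (h ` {z. \<forall>k. z $ k \<in> stolz (\<beta> k)}) \<longrightarrow>
        (\<exists>a :: ('n \<Rightarrow> nat) \<Rightarrow> complex.
           (\<forall>i. norm (a i) \<le> C * (SUP z\<in>{z. \<forall>k. z $ k \<in> stolz (\<beta> k)}. norm (h z))) \<and>
           (\<forall>\<zeta>. (\<forall>k. \<zeta> $ k \<in> stolz (\<alpha> k)) \<longrightarrow>
              ((\<lambda>i. a i * (\<Prod>k\<in>UNIV. \<Psi> k (i k) (\<zeta> $ k) * \<Psi> k (i k) (\<zeta> $ k))) has_sum h \<zeta>) UNIV))"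
    proof (intro exI[of _ "K ^ CARD('n)"] conjI allI impI)
      fix h :: "complex ^ 'n \<Rightarrow> complex"
      assume h: "holo_several h {z. \<forall>k. z $ k \<in> stolz (\<beta> k)} \<and> bounded (h ` {z. \<forall>k. z $ k \<in> stolz (\<beta> k)})"
      obtain a where a: "\<And>i. norm (a i) \<le> K ^ CARD('n) * (SUP z\<in>{z. \<forall>k. z $ k \<in> stolz (\<beta> k)}. norm (h z))"
        "\<And>\<zeta>. \<forall>k. \<zeta> $ k \<in> stolz (\<alpha> k) \<Longrightarrow> ((\<lambda>i. a i * (\<Prod>k\<in>UNIV. \<Psi> k (i k) (\<zeta> $ k) ^ 2)) has_sum h \<zeta>) UNIV"
      proof (rule product_representation[of index_measure fst "\<lambda>k. stolz (\<beta> k)" "\<lambda>k. stolz (\<alpha> k)" w \<phi> K "\<lambda>k i \<zeta>. \<Psi> k i \<zeta> ^ 2" h])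
        interpret pair_sigma_finite "count_space (UNIV :: nat set)" "lborel :: real measure"
          by (intro pair_sigma_finite.intro sigma_finite_measure_count_space_countable sigma_finite_lborel) auto
        show "sigma_finite_measure index_measure" by unfold_locales
        show "stolz (\<alpha> k) \<subseteq> stolz (\<beta> k)" for k
          using assms stolz_mono[of "\<alpha> k" "\<beta> k"] less_imp_le by blast
        show "(\<integral>x. norm (indicator {x. fst x = i} x * \<phi> k x) \<partial>index_measure) \<le> K" for k i
          using sys[of k] CK[of k] order_trans by blast
      qed (use sys h open_stolz in \<open>blast | simp\<close>)+
      show "\<exists>a. (\<forall>i. norm (a i) \<le> K ^ CARD('n) * (SUP z\<in>{z. \<forall>k. z $ k \<in> stolz (\<beta> k)}. norm (h z))) \<and>
           (\<forall>\<zeta>. (\<forall>k. \<zeta> $ k \<in> stolz (\<alpha> k)) \<longrightarrow>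
              ((\<lambda>i. a i * (\<Prod>k\<in>UNIV. \<Psi> k (i k) (\<zeta> $ k) * \<Psi> k (i k) (\<zeta> $ k))) has_sum h \<zeta>) UNIV)"
        using a by (intro exI[of _ a]) (simp add: power2_eq_square)
    qed (use K in simp)
  qed
qed

end
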